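(* Let $\Gamma$ be a finite simplicial graph that is not a clique and that has no separating cliques. Then the right-angled Artin group $A_\Gamma$ is not commensurable to any group splitting non-trivially over an NF subgroup.
   Context: For a finite simplicial graph $\Gamma$, the right-angled Artin group $A_\Gamma$ is the group with one generator for each vertex of $\Gamma$ and with defining relations that two generators commute if and only if the corresponding vertices span an edge. A clique is a graph in which every pair of distinct vertices spans an edge (the empty graph counts as a clique). A (possibly empty) induced subgraph $\Delta$ of $\Gamma$ is separating if $\Gamma\setminus\Delta$ (the induced subgraph on the vertices not in $\Delta$) is disconnected, i.e. has at least two connected components. Two groups are (abstractly) commensurable if they contain isomorphic finite index subgroups. A group $G$ splits non-trivially over a subgroup $C$ if $G$ decomposes as an amalgamated product $G=A*_C B$ with $G\ne A,B$ or as an HNN-extension $G=A*_C$ with $G\ne A$. A group is NF if it contains no non-abelian free subgroups. *)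

theory Defs
  imports "HOL-Algebra.Coset" "Graph_Theory.Graph_Theory"
begin

section \<open>Graphs\<close>

text \<open>
  Finite simplicial graphs are the digraphs satisfying the locale predicate \<^const>\<open>graph\<close> (finite,
  symmetric, without loops or parallel arcs); \<^term>\<open>arcs_ends \<Gamma>\<close> is the adjacency relation.
\<close>

text \<open>\<^const>\<open>complete_digraph\<close> admits the empty graph, with parameter 0.\<close>

definition clique :: "('v, 'e) pre_digraph \<Rightarrow> bool" where
  "clique \<Gamma> \<longleftrightarrow> (\<exists>n. complete_digraph n \<Gamma>)"

definition connected_components :: "('v, 'e) pre_digraph \<Rightarrow> ('v, 'e) pre_digraph set" where
  "connected_components \<Gamma> = {K. pre_digraph.max_subgraph \<Gamma> Digraph_Component.connected K}"

text \<open>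
  Disconnected means having at least two components.  This is not the negation of
  \<^const>\<open>Digraph_Component.connected\<close>: the empty graph has no component at all and is neither.
\<close>

definition separating :: "('v, 'e) pre_digraph \<Rightarrow> ('v, 'e) pre_digraph \<Rightarrow> bool" where
  "separating \<Gamma> \<Delta> \<longleftrightarrow>
     (\<exists>K L. K \<in> connected_components (\<Gamma> \<restriction> (verts \<Gamma> - verts \<Delta>)) \<and>
            L \<in> connected_components (\<Gamma> \<restriction> (verts \<Gamma> - verts \<Delta>)) \<and> K \<noteq> L)"


section \<open>Group presentations\<close>

text \<open>
  In a word, \<^term>\<open>(x, True)\<close> stands for the generator \<open>x\<close> and \<^term>\<open>(x, False)\<close> for its formal
  inverse.  A relator \<^term>\<open>(r, s)\<close> stands for the equation \<open>r = s\<close>.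
\<close>

type_synonym 'x word = "('x \<times> bool) list"

inductive_set pres_rel :: "'x set \<Rightarrow> ('x word \<times> 'x word) set \<Rightarrow> ('x word \<times> 'x word) set"
  for X :: "'x set" and R :: "('x word \<times> 'x word) set" where
  refl: "w \<in> lists (X \<times> UNIV) \<Longrightarrow> (w, w) \<in> pres_rel X R"
| sym: "(v, w) \<in> pres_rel X R \<Longrightarrow> (w, v) \<in> pres_rel X R"
| trans: "(u, v) \<in> pres_rel X R \<Longrightarrow> (v, w) \<in> pres_rel X R \<Longrightarrow> (u, w) \<in> pres_rel X R"
| cancel: "u \<in> lists (X \<times> UNIV) \<Longrightarrow> v \<in> lists (X \<times> UNIV) \<Longrightarrow> x \<in> X \<Longrightarrow>
    (u @ [(x, b), (x, \<not> b)] @ v, u @ v) \<in> pres_rel X R"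
| relator: "u \<in> lists (X \<times> UNIV) \<Longrightarrow> v \<in> lists (X \<times> UNIV) \<Longrightarrow>
    r \<in> lists (X \<times> UNIV) \<Longrightarrow> s \<in> lists (X \<times> UNIV) \<Longrightarrow> (r, s) \<in> R \<Longrightarrow>
    (u @ r @ v, u @ s @ v) \<in> pres_rel X R"

definition presented_group :: "'x set \<Rightarrow> ('x word \<times> 'x word) set \<Rightarrow> 'x word set monoid" where
  "presented_group X R =
     \<lparr>carrier = lists (X \<times> UNIV) // pres_rel X R,
      monoid.mult = (\<lambda>P Q. \<Union>u\<in>P. \<Union>v\<in>Q. pres_rel X R `` {u @ v}),
      one = pres_rel X R `` {[]}\<rparr>"

definition pres_gen :: "'x set \<Rightarrow> ('x word \<times> 'x word) set \<Rightarrow> 'x \<Rightarrow> 'x word set" where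
  "pres_gen X R x = pres_rel X R `` {[(x, True)]}"

lemma pres_rel_in_lists:
  assumes "(v, w) \<in> pres_rel X R"
  shows "v \<in> lists (X \<times> UNIV) \<and> w \<in> lists (X \<times> UNIV)"
  using assms by induction auto

lemma equiv_pres_rel: "equiv (lists (X \<times> UNIV)) (pres_rel X R)"
  using pres_rel_in_lists[of _ _ X R]
  by (intro equivI refl_onI symI transI subsetI)
     (auto intro: pres_rel.refl pres_rel.sym pres_rel.trans)

lemma pres_rel_context:
  assumes "(v, w) \<in> pres_rel X R" and "p \<in> lists (X \<times> UNIV)" and "q \<in> lists (X \<times> UNIV)"
  shows "(p @ v @ q, p @ w @ q) \<in> pres_rel X R"
  using assms
proof (induction arbitrary: p q)
  case (refl w)
  then show ?case by (auto intro!: pres_rel.refl)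
next
  case (sym v w)
  then show ?case by (blast intro: pres_rel.sym)
next
  case (trans u v w)
  then show ?case by (blast intro: pres_rel.trans)
next
  case (cancel u v x b)
  then show ?case using pres_rel.cancel[of "p @ u" X "v @ q" x b R] by simp
next
  case (relator u v r s)
  then show ?case using pres_rel.relator[of "p @ u" X "v @ q" r s R] by simp
qed

lemma pres_rel_append:
  assumes "(u, u') \<in> pres_rel X R" and "(v, v') \<in> pres_rel X R"
  shows "(u @ v, u' @ v') \<in> pres_rel X R"
proof -
  have "(u @ v, u' @ v) \<in> pres_rel X R"
    using pres_rel_context[OF assms(1), of "[]" v] pres_rel_in_lists[OF assms(2)] by simp
  moreover have "(u' @ v, u' @ v') \<in> pres_rel X R"
    using pres_rel_context[OF assms(2), of u' "[]"] pres_rel_in_lists[OF assms(1)] by simp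
  ultimately show ?thesis by (rule pres_rel.trans)
qed

lemma presented_group_mult:
  assumes "u \<in> lists (X \<times> UNIV)" and "v \<in> lists (X \<times> UNIV)"
  shows "pres_rel X R `` {u} \<otimes>\<^bsub>presented_group X R\<^esub> pres_rel X R `` {v} = pres_rel X R `` {u @ v}"
proof -
  have "pres_rel X R `` {u' @ v'} = pres_rel X R `` {u @ v}"
    if "u' \<in> pres_rel X R `` {u}" "v' \<in> pres_rel X R `` {v}" for u' v'
    using equiv_class_eq[OF equiv_pres_rel pres_rel_append[of u u' X R v v']] that by simp
  moreover have "u \<in> pres_rel X R `` {u}" "v \<in> pres_rel X R `` {v}"
    using assms by (auto intro: pres_rel.refl)
  ultimately have "(\<Union>u'\<in>pres_rel X R `` {u}. \<Union>v'\<in>pres_rel X R `` {v}. pres_rel X R `` {u' @ v'}) =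
      pres_rel X R `` {u @ v}" by blast
  then show ?thesis by (simp add: presented_group_def)
qed

lemma pres_rel_left_inverse:
  assumes "w \<in> lists (X \<times> UNIV)"
  shows "(rev (map (\<lambda>(x, b). (x, \<not> b)) w) @ w, []) \<in> pres_rel X R"
  using assms
proof (induction w)
  case Nil
  then show ?case by (simp add: pres_rel.refl)
next
  case (Cons a w)
  obtain x b where a: "a = (x, b)" by fastforce
  let ?i = "rev (map (\<lambda>(x, b). (x, \<not> b)) w)"
  have i: "?i \<in> lists (X \<times> UNIV)" using Cons.hyps Cons.prems by auto
  have "(?i @ [(x, \<not> b), (x, \<not> \<not> b)] @ w, ?i @ w) \<in> pres_rel X R"
    using i Cons a by (intro pres_rel.cancel) auto
  then show ?case using Cons a by (auto intro: pres_rel.trans)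
qed

lemma group_presented_group: "group (presented_group X R)"
proof (rule groupI)
  have cls: "\<exists>w\<in>lists (X \<times> UNIV). P = pres_rel X R `` {w}" if "P \<in> carrier (presented_group X R)" for P
    using that by (auto simp: presented_group_def elim!: quotientE)
  have incl: "pres_rel X R `` {w} \<in> carrier (presented_group X R)" if "w \<in> lists (X \<times> UNIV)" for w
    using that by (simp add: presented_group_def quotientI)
  have app: "u @ v \<in> lists (X \<times> UNIV)" if "u \<in> lists (X \<times> UNIV)" "v \<in> lists (X \<times> UNIV)" for u v :: "'a word"
    using that by auto
  have one: "\<one>\<^bsub>presented_group X R\<^esub> = pres_rel X R `` {[]}" by (simp add: presented_group_def)
  show "\<one>\<^bsub>presented_group X R\<^esub> \<in> carrier (presented_group X R)" unfolding one by (rule incl) simp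
  fix P assume "P \<in> carrier (presented_group X R)"
  then obtain u where u: "u \<in> lists (X \<times> UNIV)" "P = pres_rel X R `` {u}" using cls by blast
  show "\<one>\<^bsub>presented_group X R\<^esub> \<otimes>\<^bsub>presented_group X R\<^esub> P = P"
    using presented_group_mult[of "[]" X u R] u one by simp
  let ?i = "rev (map (\<lambda>(x, b). (x, \<not> b)) u)"
  have i: "?i \<in> lists (X \<times> UNIV)" using u(1) by auto
  have "pres_rel X R `` {?i} \<otimes>\<^bsub>presented_group X R\<^esub> P = \<one>\<^bsub>presented_group X R\<^esub>"
    using presented_group_mult[OF i u(1), of R] u(2) one
      equiv_class_eq[OF equiv_pres_rel pres_rel_left_inverse[OF u(1), of R]] by simp
  then show "\<exists>Q\<in>carrier (presented_group X R). Q \<otimes>\<^bsub>presented_group X R\<^esub> P = \<one>\<^bsub>presented_group X R\<^esub>"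
    using incl[OF i] by blast
  fix Q assume "Q \<in> carrier (presented_group X R)"
  then obtain v where v: "v \<in> lists (X \<times> UNIV)" "Q = pres_rel X R `` {v}" using cls by blast
  show "P \<otimes>\<^bsub>presented_group X R\<^esub> Q \<in> carrier (presented_group X R)"
    unfolding u(2) v(2) presented_group_mult[OF u(1) v(1)] by (rule incl[OF app[OF u(1) v(1)]])
  fix S assume "S \<in> carrier (presented_group X R)"
  then obtain w where w: "w \<in> lists (X \<times> UNIV)" "S = pres_rel X R `` {w}" using cls by blast
  show "P \<otimes>\<^bsub>presented_group X R\<^esub> Q \<otimes>\<^bsub>presented_group X R\<^esub> S =
        P \<otimes>\<^bsub>presented_group X R\<^esub> (Q \<otimes>\<^bsub>presented_group X R\<^esub> S)"
    unfolding u(2) v(2) w(2) presented_group_mult[OF u(1) v(1)] presented_group_mult[OF v(1) w(1)]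
      presented_group_mult[OF app[OF u(1) v(1)] w(1)] presented_group_mult[OF u(1) app[OF v(1) w(1)]]
    by simp
qed

definition raag :: "('v, 'e) pre_digraph \<Rightarrow> 'v word set monoid" where
  "raag \<Gamma> = presented_group (verts \<Gamma>)
     {([(u, True), (v, True)], [(v, True), (u, True)]) | u v. (u, v) \<in> arcs_ends \<Gamma>}"


section \<open>Commensurability and NF groups\<close>

definition finite_index_subgroup :: "'a set \<Rightarrow> ('a, 'm) monoid_scheme \<Rightarrow> bool" where
  "finite_index_subgroup H G \<longleftrightarrow> subgroup H G \<and> finite (rcosets\<^bsub>G\<^esub> H)"

definition commensurable :: "('a, 'm) monoid_scheme \<Rightarrow> ('b, 'n) monoid_scheme \<Rightarrow> bool" where
  "commensurable G H \<longleftrightarrow>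
     (\<exists>U V. finite_index_subgroup U G \<and> finite_index_subgroup V H \<and>
            G\<lparr>carrier := U\<rparr> \<cong> H\<lparr>carrier := V\<rparr>)"

text \<open>
  A basis of a free group is a subset of its carrier, so sets \<open>X\<close> over the element type suffice.
\<close>

definition free_group :: "('a, 'm) monoid_scheme \<Rightarrow> bool" where
  "free_group G \<longleftrightarrow> (\<exists>X :: 'a set. presented_group X {} \<cong> G)"

definition NF_group :: "('a, 'm) monoid_scheme \<Rightarrow> bool" where
  "NF_group G \<longleftrightarrow>
     \<not> (\<exists>H. subgroup H G \<and> free_group (G\<lparr>carrier := H\<rparr>) \<and> \<not> comm_group (G\<lparr>carrier := H\<rparr>))"


section \<open>Splittings\<close>

definition mult_table :: "('a, 'm) monoid_scheme \<Rightarrow> ('a \<Rightarrow> 'x) \<Rightarrow> ('x word \<times> 'x word) set" where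
  "mult_table A i =
     {([(i a, True), (i b, True)], [(i (a \<otimes>\<^bsub>A\<^esub> b), True)]) | a b. a \<in> carrier A \<and> b \<in> carrier A}"

text \<open>
  The amalgamated product of \<open>A\<close> and \<open>B\<close> along a common subgroup \<open>C\<close>: generated by disjoint copies
  of \<open>A\<close> and \<open>B\<close>, subject to their multiplication tables and the identification of the two
  copies of \<open>C\<close>.
\<close>

abbreviation amalgam_gens :: "('a, 'm) monoid_scheme \<Rightarrow> ('a, 'm) monoid_scheme \<Rightarrow> ('a + 'a) set" where
  "amalgam_gens A B \<equiv> carrier A <+> carrier B"

definition amalgam_rels ::
  "('a, 'm) monoid_scheme \<Rightarrow> ('a, 'm) monoid_scheme \<Rightarrow> 'a set \<Rightarrow> (('a + 'a) word \<times> ('a + 'a) word) set" where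
  "amalgam_rels A B C = mult_table A Inl \<union> mult_table B Inr \<union>
     {([(Inl c, True)], [(Inr c, True)]) | c. c \<in> C}"

abbreviation amalgamated_product where
  "amalgamated_product A B C \<equiv> presented_group (amalgam_gens A B) (amalgam_rels A B C)"

text \<open>
  The HNN-extension of \<open>A\<close> with associated subgroups \<open>C\<close> and \<open>\<phi> ` C\<close>: the generator \<^term>\<open>None\<close> is the
  stable letter \<open>t\<close>, with relations \<open>t\<^sup>-\<^sup>1 c t = \<phi> c\<close>.
\<close>

abbreviation hnn_gens :: "('a, 'm) monoid_scheme \<Rightarrow> 'a option set" where
  "hnn_gens A \<equiv> insert None (Some ` carrier A)"

definition hnn_rels ::
  "('a, 'm) monoid_scheme \<Rightarrow> 'a set \<Rightarrow> ('a \<Rightarrow> 'a) \<Rightarrow> ('a option word \<times> 'a option word) set" where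
  "hnn_rels A C \<phi> = mult_table A Some \<union>
     {([(None, False), (Some c, True), (None, True)], [(Some (\<phi> c), True)]) | c. c \<in> C}"

abbreviation hnn_extension where
  "hnn_extension A C \<phi> \<equiv> presented_group (hnn_gens A) (hnn_rels A C \<phi>)"

text \<open>
  Decompositions are internal: the isomorphism from the amalgamated product (HNN-extension) restricts
  to the inclusions of the factors (the base group).
\<close>

definition splits_as_amalgam_over :: "('a, 'm) monoid_scheme \<Rightarrow> 'a set \<Rightarrow> bool" where
  "splits_as_amalgam_over G C \<longleftrightarrow>
     (\<exists>A B. subgroup A G \<and> subgroup B G \<and> C \<subseteq> A \<and> C \<subseteq> B \<and> A \<noteq> carrier G \<and> B \<noteq> carrier G \<and>
        (let GA = G\<lparr>carrier := A\<rparr>; GB = G\<lparr>carrier := B\<rparr>;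
             \<iota> = pres_gen (amalgam_gens GA GB) (amalgam_rels GA GB C)
         in \<exists>\<psi> \<in> iso (amalgamated_product GA GB C) G.
              (\<forall>a\<in>A. \<psi> (\<iota> (Inl a)) = a) \<and> (\<forall>b\<in>B. \<psi> (\<iota> (Inr b)) = b)))"

definition splits_as_hnn_over :: "('a, 'm) monoid_scheme \<Rightarrow> 'a set \<Rightarrow> bool" where
  "splits_as_hnn_over G C \<longleftrightarrow>
     (\<exists>A \<phi>. subgroup A G \<and> C \<subseteq> A \<and> A \<noteq> carrier G \<and>
        \<phi> \<in> mon (G\<lparr>carrier := C\<rparr>) (G\<lparr>carrier := A\<rparr>) \<and>
        (let GA = G\<lparr>carrier := A\<rparr>; \<iota> = pres_gen (hnn_gens GA) (hnn_rels GA C \<phi>)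
         in \<exists>\<psi> \<in> iso (hnn_extension GA C \<phi>) G. \<forall>a\<in>A. \<psi> (\<iota> (Some a)) = a))"

definition splits_nontrivially_over :: "('a, 'm) monoid_scheme \<Rightarrow> 'a set \<Rightarrow> bool" where
  "splits_nontrivially_over G C \<longleftrightarrow>
     subgroup C G \<and> (splits_as_amalgam_over G C \<or> splits_as_hnn_over G C)"

end

theory Submission
  imports Defs
begin

text \<open>
  A splitting of \<open>G\<close> over \<open>C\<close> yields an action of \<open>G\<close> on its Bass--Serre tree without a global fixed
  point.  A finite index subgroup of the Artin group contains a fixed power \<open>v\<^sup>N\<close> of each
  generator \<open>v\<close>, and so acts on the tree with NF edge stabilizers.  Since the link of \<open>v\<close> is not a clique, the
  centralizer of \<open>v\<^sup>N\<close> contains a non-abelian free group; if \<open>v\<^sup>N\<close> were hyperbolic, commutators from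
  this free group would fix an edge of its axis.  So each \<open>v\<^sup>N\<close> is elliptic.  If the fixed subtrees
  of \<open>u\<^sup>N\<close> and \<open>v\<^sup>N\<close> were disjoint, take an edge between them: the generators whose power fixes it
  form a clique, and the fixed subtrees of the others, linked by paths avoiding this clique, would
  all lie on the same side of the edge.  By the Helly property all \<open>v\<^sup>N\<close> have a common
  fixed point, which is unique because free groups fix no edge.  Uniqueness makes it invariant under
  conjugation by the generators, then under the finite index subgroup, and finally under \<open>G\<close>.
\<close>

section \<open>Words and free families\<close>

text \<open>That a Bass--Serre tree has no cycles is usually read off from normal forms. Here it
  comes from the universal property of the presentation: every edge needs a wall, by translation one
  wall for the base edge is enough, and its two-colouring is a function on the group with prescribed
  increments mod 2 along the generators, for which only the relators have to be checked. Distances,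
  first edges of geodesics and convexity are then derived from walls. No axis is constructed for a
  hyperbolic \<open>x\<close>: a half-space \<open>H\<close> that \<open>x\<close> maps strictly
  into itself takes its place. An element commuting with \<open>x\<close> has a power that moves
  \<open>H\<close> as some power of \<open>x\<close> does; the exponents add up, so commutators of
  such powers preserve \<open>H\<close>. The Artin group need not act on the tree, only its finite
  index subgroup does. So the fixed point cannot be moved by generators; instead the families of
  conjugates g v^N g^-1, which all lie in the subgroup, are compared for neighbouring g in the
  Cayley graph.\<close>

fun word_eval :: "('a, 'm) monoid_scheme \<Rightarrow> ('x \<Rightarrow> 'a) \<Rightarrow> 'x word \<Rightarrow> 'a" where
  "word_eval G f [] = \<one>\<^bsub>G\<^esub>"
| "word_eval G f ((x, b) # w) = (if b then f x else inv\<^bsub>G\<^esub> (f x)) \<otimes>\<^bsub>G\<^esub> word_eval G f w"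

definition reduced :: "'x word \<Rightarrow> bool" where
  "reduced w \<longleftrightarrow> successively (\<lambda>p q. q \<noteq> (fst p, \<not> snd p)) w"

text \<open>Freeness is encoded by reduced words and not by an isomorphism with a free group, since
  words pass directly to powers, conjugates, subgroups and injective images. With index type
  \<open>bool\<close> the family freely generates a group of rank two.\<close>

definition free_family :: "('a, 'm) monoid_scheme \<Rightarrow> ('x \<Rightarrow> 'a) \<Rightarrow> bool" where
  "free_family G f \<longleftrightarrow> range f \<subseteq> carrier G \<and> (\<forall>w. reduced w \<and> w \<noteq> [] \<longrightarrow> word_eval G f w \<noteq> \<one>\<^bsub>G\<^esub>)"

definition inv_word :: "'x word \<Rightarrow> 'x word" where
  "inv_word w = rev (map (\<lambda>(x, b). (x, \<not> b)) w)"

definition subst_letter :: "('y \<Rightarrow> 'x word) \<Rightarrow> 'y \<times> bool \<Rightarrow> 'x word" where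
  "subst_letter g p = (if snd p then g (fst p) else inv_word (g (fst p)))"

context group
begin

lemma word_eval_closed:
  assumes "f ` fst ` set w \<subseteq> carrier G"
  shows "word_eval G f w \<in> carrier G"
  using assms
proof (induction w)
  case (Cons p w)
  then show ?case by (cases p) auto
qed simp

lemma word_eval_append:
  assumes "f ` fst ` set (u @ v) \<subseteq> carrier G"
  shows "word_eval G f (u @ v) = word_eval G f u \<otimes> word_eval G f v"
  using assms
proof (induction u)
  case Nil
  then show ?case using word_eval_closed[of f v] by simp
next
  case (Cons p u)
  obtain x b where p: "p = (x, b)" by fastforce
  have "f x \<in> carrier G" using Cons.prems p by simp
  moreover have "word_eval G f u \<in> carrier G" "word_eval G f v \<in> carrier G"
    using Cons.prems by (auto intro!: word_eval_closed)
  moreover have "word_eval G f (u @ v) = word_eval G f u \<otimes> word_eval G f v" using Cons by simp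
  ultimately show ?case using p by (simp add: m_assoc)
qed

lemma word_eval_inv_word:
  assumes "f ` fst ` set w \<subseteq> carrier G"
  shows "word_eval G f (inv_word w) = inv (word_eval G f w)"
  using assms
proof (induction w)
  case Nil
  then show ?case by (simp add: inv_word_def)
next
  case (Cons p w)
  obtain x b where p: "p = (x, b)" by fastforce
  have x: "f x \<in> carrier G" using Cons.prems p by simp
  have w: "f ` fst ` set w \<subseteq> carrier G" using Cons.prems by auto
  have "word_eval G f (inv_word (p # w)) = word_eval G f (inv_word w) \<otimes> word_eval G f [(x, \<not> b)]"
    unfolding p inv_word_def using x w by (subst word_eval_append[symmetric]) (auto simp: image_image)
  then show ?case using Cons.IH[OF w] x word_eval_closed[OF w] p by (auto simp: inv_mult_group)
qed

lemma word_eval_hom: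
  assumes "group H" "h \<in> hom G H" "f ` fst ` set w \<subseteq> carrier G"
  shows "word_eval H (\<lambda>x. h (f x)) w = h (word_eval G f w)"
  using assms(3)
proof (induction w)
  case Nil
  then show ?case using assms(1,2) hom_one[OF assms(2) is_group assms(1)] by simp
next
  case (Cons p w)
  interpret h: group_hom G H h using assms(1,2) is_group
    by (simp add: group_hom_def group_hom_axioms_def)
  obtain x b where p: "p = (x, b)" by fastforce
  have "f x \<in> carrier G" using Cons.prems p by simp
  moreover have "word_eval G f w \<in> carrier G"
    using Cons.prems by (auto intro!: word_eval_closed)
  ultimately show ?case using Cons p by (auto simp: h.hom_inv)
qed

lemma word_eval_subst:
  assumes "range f \<subseteq> carrier G"
  shows "word_eval G f (concat (map (subst_letter g) w)) = word_eval G (\<lambda>y. word_eval G f (g y)) w"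
proof (induction w)
  case (Cons p w)
  obtain y b where "p = (y, b)" by fastforce
  moreover have "word_eval G f (u @ v) = word_eval G f u \<otimes> word_eval G f v" for u v
    using assms by (intro word_eval_append) auto
  moreover have "word_eval G f (inv_word u) = inv (word_eval G f u)" for u
    using assms by (intro word_eval_inv_word) auto
  ultimately show ?case using Cons by (simp add: subst_letter_def)
qed simp

text \<open>The hypotheses exclude cancellation where two blocks meet, so substitution turns a
  nonempty reduced word into a nonempty reduced word. Blocks are nonempty so that only neighbouring
  ones touch.\<close>

lemma free_family_subst:
  assumes "free_family G f"
    and ne: "\<And>p. subst_letter g p \<noteq> []"
    and red: "\<And>p q. q \<noteq> (fst p, \<not> snd p) \<Longrightarrow> reduced (subst_letter g p @ subst_letter g q)"
  shows "free_family G (\<lambda>y. word_eval G f (g y))"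
proof -
  have r: "range f \<subseteq> carrier G" using assms(1) by (simp add: free_family_def)
  have red1: "reduced (subst_letter g p)" for p
    using red[of p p] by (auto simp: reduced_def successively_append_iff prod_eq_iff)
  have sub: "reduced (concat (map (subst_letter g) w))" if "reduced w" for w
    using that
  proof (induction w rule: induct_list012)
    case (3 p q w)
    have "reduced (concat (map (subst_letter g) (q # w)))" "q \<noteq> (fst p, \<not> snd p)"
      using 3 by (auto simp: reduced_def)
    then show ?case using red[of q p] ne[of q] by (auto simp: reduced_def successively_append_iff)
  qed (use red1 in \<open>auto simp: reduced_def\<close>)
  have nonempty: "concat (map (subst_letter g) w) \<noteq> []" if "w \<noteq> []" for w
    using that ne by (cases w) auto
  show ?thesis
    using assms(1) r sub nonempty
    by (auto simp: free_family_def word_eval_subst[OF r, symmetric] intro!: word_eval_closed)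
qed

lemma word_eval_replicate:
  "f y \<in> carrier G \<Longrightarrow> word_eval G f (replicate m (y, True)) = f y [^] m"
proof (induction m)
  case (Suc m)
  then show ?case using nat_pow_mult[of "f y" 1 m] by simp
qed simp

lemma free_family_power:
  fixes f :: "'x \<Rightarrow> 'a"
  assumes "free_family G f" "m > 0"
  shows "free_family G (\<lambda>y. f y [^] (m :: nat))"
proof -
  have s: "subst_letter (\<lambda>y. replicate m (y, True)) p = replicate m p" for p :: "'x \<times> bool"
    by (cases p) (auto simp: subst_letter_def inv_word_def)
  have "successively (\<lambda>p q. q \<noteq> (fst p, \<not> snd p)) (replicate k p)" for k and p :: "'x \<times> bool"
  proof (induction k)
    case (Suc k)
    then show ?case by (cases k) (auto simp: prod_eq_iff)
  qed simp
  then have "free_family G (\<lambda>y. word_eval G f (replicate m (y, True)))"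
    using assms(2) by (intro free_family_subst[OF assms(1)])
      (auto simp: s reduced_def successively_append_iff)
  moreover have "word_eval G f (replicate m (y, True)) = f y [^] m" for y
    using assms(1) by (intro word_eval_replicate) (auto simp: free_family_def)
  ultimately show ?thesis by simp
qed

text \<open>With a = \<open>f True\<close> and b = \<open>f False\<close>, the blocks [a, b],
  [a^-1, b^-1] and their inverses begin with four different letters. Hence cancellation at a
  junction occurs only between a block and its own inverse.\<close>

lemma free_family_commutators:
  assumes "free_family G f"
  shows "free_family G (\<lambda>y. if y then f True \<otimes> f False \<otimes> inv (f True) \<otimes> inv (f False)
    else inv (f True) \<otimes> inv (f False) \<otimes> f True \<otimes> f False)"
proof -
  let ?g = "\<lambda>y. if y then [(True, True), (False, True), (True, False), (False, False)]
    else [(True, False), (False, False), (True, True), (False, True)]"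
  have "free_family G (\<lambda>y. word_eval G f (?g y))"
  proof (rule free_family_subst[OF assms])
    fix p show "subst_letter ?g p \<noteq> []"
      by (auto simp: subst_letter_def inv_word_def)
  next
    fix p q :: "bool \<times> bool"
    assume "q \<noteq> (fst p, \<not> snd p)"
    then show "reduced (subst_letter ?g p @ subst_letter ?g q)"
      by (cases p; cases q) (auto simp: subst_letter_def inv_word_def reduced_def split: if_splits)
  qed
  moreover have "word_eval G f (?g y) = (if y then f True \<otimes> f False \<otimes> inv (f True) \<otimes> inv (f False)
    else inv (f True) \<otimes> inv (f False) \<otimes> f True \<otimes> f False)" for y
    using assms by (auto simp: free_family_def image_subset_iff m_assoc)
  ultimately show ?thesis by simp
qed

lemma free_family_hom:
  assumes "free_family G f" "group H" "h \<in> hom G H" "inj_on h (carrier G)"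
  shows "free_family H (\<lambda>x. h (f x))"
proof -
  have r: "range f \<subseteq> carrier G" using assms(1) by (simp add: free_family_def)
  then have c: "word_eval G f w \<in> carrier G" for w by (auto intro!: word_eval_closed)
  have "word_eval H (\<lambda>x. h (f x)) w = h (word_eval G f w)" for w
    using r by (intro word_eval_hom[OF assms(2,3)]) auto
  moreover have "h \<one> = \<one>\<^bsub>H\<^esub>" using hom_one[OF assms(3) is_group assms(2)] .
  ultimately have "word_eval G f w = \<one>" if "word_eval H (\<lambda>x. h (f x)) w = \<one>\<^bsub>H\<^esub>" for w
    using that c assms(4) by (metis inj_onD one_closed)
  then show ?thesis using assms(1,3) r by (auto simp: free_family_def hom_def)
qed

lemma free_family_conj:
  assumes "free_family G f" "g \<in> carrier G"
  shows "free_family G (\<lambda>x. g \<otimes> f x \<otimes> inv g)"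
proof (rule free_family_hom[OF assms(1) is_group])
  show "(\<lambda>y. g \<otimes> y \<otimes> inv g) \<in> hom G G"
    using assms(2) by (auto simp: hom_def m_assoc inv_solve_left')
      (metis inv_closed inv_solve_left m_assoc m_closed)
  show "inj_on (\<lambda>y. g \<otimes> y \<otimes> inv g) (carrier G)"
    using assms(2) by (auto intro!: inj_onI)
qed

lemma word_eval_subgroup:
  assumes "subgroup H G" "range f \<subseteq> H"
  shows "word_eval (G\<lparr>carrier := H\<rparr>) f w = word_eval G f w"
proof (induction w)
  case (Cons p w)
  then show ?case using assms by (cases p) (auto simp: m_inv_consistent image_subset_iff)
qed simp

lemma free_family_subgroup:
  assumes "subgroup H G" "range f \<subseteq> H"
  shows "free_family (G\<lparr>carrier := H\<rparr>) f \<longleftrightarrow> free_family G f"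
  using assms subgroup.subset[OF assms(1)] by (auto simp: free_family_def word_eval_subgroup)

lemma word_eval_pres_rel:
  assumes "(v, w) \<in> pres_rel X R" "f ` X \<subseteq> carrier G"
    and "\<And>r s. (r, s) \<in> R \<Longrightarrow> r \<in> lists (X \<times> UNIV) \<Longrightarrow> s \<in> lists (X \<times> UNIV)
           \<Longrightarrow> word_eval G f r = word_eval G f s"
  shows "word_eval G f v = word_eval G f w"
  using assms(1)
proof induction
  case (cancel u v x b)
  have "word_eval G f (u @ [(x, b), (x, \<not> b)] @ v) =
      word_eval G f u \<otimes> (word_eval G f [(x, b), (x, \<not> b)] \<otimes> word_eval G f v)"
    using cancel assms(2) by (subst word_eval_append | force)+
  moreover have "word_eval G f (u @ v) = word_eval G f u \<otimes> word_eval G f v"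
    using cancel assms(2) by (subst word_eval_append | force)+
  moreover have "word_eval G f v \<in> carrier G" using cancel assms(2)
    by (intro word_eval_closed) force
  ultimately show ?case using cancel assms(2) by (auto simp: image_subset_iff)
next
  case (relator u v r s)
  have "word_eval G f (u @ t @ v) = word_eval G f u \<otimes> (word_eval G f t \<otimes> word_eval G f v)"
    if "t \<in> lists (X \<times> UNIV)" for t
    using relator that assms(2) by (subst word_eval_append | force)+
  then show ?case using relator assms(3) by simp
qed auto

end

section \<open>Free subgroups obtained from free families\<close>

lemma pres_rel_reduced:
  assumes "w \<in> lists (X \<times> UNIV)"
  shows "\<exists>w'. (w, w') \<in> pres_rel X R \<and> reduced w'"
  using assms
proof (induction "length w" arbitrary: w rule: less_induct)
  case less
  show ?case
  proof (cases "reduced w")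
    case True
    then show ?thesis using less.prems pres_rel.refl by blast
  next
    case False
    then have "\<exists>u p v. w = u @ [p, (fst p, \<not> snd p)] @ v"
      unfolding reduced_def
    proof (induction w rule: induct_list012)
      case (3 p q w)
      show ?case
      proof (cases "q = (fst p, \<not> snd p)")
        case True
        then show ?thesis by (intro exI[of _ "[]"]) auto
      next
        case False
        then obtain u p' v where "q # w = u @ [p', (fst p', \<not> snd p')] @ v" using 3 by auto
        then show ?thesis by (intro exI[of _ "p # u"]) auto
      qed
    qed auto
    then obtain u x b v where w: "w = u @ [(x, b), (x, \<not> b)] @ v" by fastforce
    then have uv: "u \<in> lists (X \<times> UNIV)" "v \<in> lists (X \<times> UNIV)" "x \<in> X" using less.prems by auto
    then have "(w, u @ v) \<in> pres_rel X R" unfolding w by (rule pres_rel.cancel)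
    moreover obtain w' where "(u @ v, w') \<in> pres_rel X R" "reduced w'"
      using less.hyps[of "u @ v"] uv w by auto
    ultimately show ?thesis using pres_rel.trans by blast
  qed
qed

lemma pres_rel_class_eq_iff:
  assumes "v \<in> lists (X \<times> UNIV)" "w \<in> lists (X \<times> UNIV)"
  shows "pres_rel X R `` {v} = pres_rel X R `` {w} \<longleftrightarrow> (v, w) \<in> pres_rel X R"
  using assms eq_equiv_class_iff[OF equiv_pres_rel] by blast

lemma carrier_presented_group:
  "carrier (presented_group X R) = (\<lambda>w. pres_rel X R `` {w}) ` lists (X \<times> UNIV)"
  by (auto simp: presented_group_def quotient_def)

lemma presented_group_hom:
  assumes "group H" "f ` X \<subseteq> carrier H"
    and "\<And>r s. (r, s) \<in> R \<Longrightarrow> r \<in> lists (X \<times> UNIV) \<Longrightarrow> s \<in> lists (X \<times> UNIV)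
           \<Longrightarrow> word_eval H f r = word_eval H f s"
  obtains h where "h \<in> hom (presented_group X R) H"
    and "\<And>w. w \<in> lists (X \<times> UNIV) \<Longrightarrow> h (pres_rel X R `` {w}) = word_eval H f w"
proof -
  interpret H: group H by fact
  define h where "h P = word_eval H f (SOME w. w \<in> P)" for P
  have h: "h (pres_rel X R `` {w}) = word_eval H f w" if "w \<in> lists (X \<times> UNIV)" for w
  proof -
    have "w \<in> pres_rel X R `` {w}" using that pres_rel.refl by auto
    then have "(SOME w'. w' \<in> pres_rel X R `` {w}) \<in> pres_rel X R `` {w}" by (rule someI)
    then show ?thesis unfolding h_def using H.word_eval_pres_rel[OF _ assms(2,3)] by fastforce
  qed
  moreover have "h \<in> hom (presented_group X R) H"
  proof (rule homI)
    fix P assume "P \<in> carrier (presented_group X R)"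
    then obtain u where u: "u \<in> lists (X \<times> UNIV)" "P = pres_rel X R `` {u}"
      by (auto simp: carrier_presented_group)
    have cu: "f ` fst ` set u \<subseteq> carrier H" using u assms(2) by force
    then show "h P \<in> carrier H" using u by (simp add: h H.word_eval_closed)
    fix Q assume "Q \<in> carrier (presented_group X R)"
    then obtain v where v: "v \<in> lists (X \<times> UNIV)" "Q = pres_rel X R `` {v}"
      by (auto simp: carrier_presented_group)
    have cv: "f ` fst ` set v \<subseteq> carrier H" using v assms(2) by force
    have "word_eval H f (u @ v) = word_eval H f u \<otimes>\<^bsub>H\<^esub> word_eval H f v"
      using cu cv by (intro H.word_eval_append) (simp add: image_Un)
    moreover have "u @ v \<in> lists (X \<times> UNIV)" using u v by auto
    ultimately show "h (P \<otimes>\<^bsub>presented_group X R\<^esub> Q) = h P \<otimes>\<^bsub>H\<^esub> h Q"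
      unfolding u(2) v(2) by (simp only: presented_group_mult[OF u(1) v(1)] h u(1) v(1))
  qed
  ultimately show thesis using that by blast
qed

text \<open>\<open>free_group\<close> takes its basis from the carrier, hence the letters are
  relabelled from indices to values of \<open>f\<close>. For injectivity, an element of the kernel
  has a reduced representative; it evaluates to one, so freeness makes it empty.\<close>

lemma (in group) free_group_range_free_family:
  assumes "free_family G f"
  shows "subgroup (range (word_eval G f)) G \<and> free_group (G\<lparr>carrier := range (word_eval G f)\<rparr>)"
proof -
  have r: "range f \<subseteq> carrier G" using assms by (simp add: free_family_def)
  have c: "word_eval G f w \<in> carrier G" for w using r by (auto intro!: word_eval_closed)
  let ?H = "range (word_eval G f)" and ?X = "range f"
  have inj: "inj f"
  proof (rule injI, rule ccontr)
    fix x y assume "f x = f y" "x \<noteq> y"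
    then have "word_eval G f [(x, True), (y, False)] = \<one>" "reduced [(x, True), (y, False)]"
      using r by (auto simp: reduced_def image_subset_iff)
    then show False using assms by (auto simp: free_family_def)
  qed
  have sub: "subgroup ?H G"
  proof (rule subgroupI)
    show "?H \<subseteq> carrier G" using c by auto
  next
    fix a assume "a \<in> ?H"
    then show "inv a \<in> ?H" using word_eval_inv_word[of f] r by (auto simp: image_subset_iff) (metis rangeI)
  next
    fix a b assume "a \<in> ?H" "b \<in> ?H"
    then show "a \<otimes> b \<in> ?H" using word_eval_append[of f] r by (auto simp: image_subset_iff) (metis rangeI)
  qed auto
  have letters: "word_eval G id (map (map_prod f id) w) = word_eval G f w" for w
    by (induction w) (auto simp: id_def)
  have lists: "lists (?X \<times> (UNIV :: bool set)) = range (map (map_prod f id))"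
  proof -
    have "?X \<times> (UNIV :: bool set) = range (map_prod f (id :: bool \<Rightarrow> bool))"
      by (metis UNIV_Times_UNIV map_prod_surj_on surj_id)
    then show ?thesis using lists_image[of "map_prod f (id :: bool \<Rightarrow> bool)" UNIV]
      by (simp only: lists_UNIV)
  qed
  obtain h where h: "h \<in> hom (presented_group ?X {}) G"
    "\<And>w. w \<in> lists (?X \<times> UNIV) \<Longrightarrow> h (pres_rel ?X {} `` {w}) = word_eval G id w"
    using presented_group_hom[OF is_group, of id ?X "{}"] r by auto
  interpret h: group_hom "presented_group ?X {}" G h
    using h(1) group_presented_group is_group by (simp add: group_hom_def group_hom_axioms_def)
  have "h ` carrier (presented_group ?X {}) = word_eval G id ` lists (?X \<times> UNIV)"
    unfolding carrier_presented_group image_image using h(2) by (intro image_cong) auto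
  also have "\<dots> = ?H" unfolding lists image_image letters ..
  finally have im: "h ` carrier (presented_group ?X {}) = ?H" .
  have "P = \<one>\<^bsub>presented_group ?X {}\<^esub>" if P: "P \<in> carrier (presented_group ?X {})" "h P = \<one>" for P
  proof -
    obtain w where w: "w \<in> lists (?X \<times> UNIV)" "P = pres_rel ?X {} `` {w}"
      using P by (auto simp: carrier_presented_group)
    obtain w' where w': "(w, w') \<in> pres_rel ?X {}" "reduced w'" using pres_rel_reduced[OF w(1)] by blast
    then have w'l: "w' \<in> lists (?X \<times> UNIV)" using pres_rel_in_lists by blast
    have P': "P = pres_rel ?X {} `` {w'}" using w w' w'l by (simp add: pres_rel_class_eq_iff)
    obtain v where v: "w' = map (map_prod f id) v" using w'l lists by auto
    have "reduced v" using w'(2) unfolding reduced_def v successively_map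
      by (rule successively_mono) (auto simp: prod_eq_iff)
    moreover have "word_eval G f v = \<one>" using P(2) P' h(2)[OF w'l] letters v by simp
    ultimately have "v = []" using assms by (auto simp: free_family_def)
    then show ?thesis using P' v by (simp add: presented_group_def)
  qed
  then have "inj_on h (carrier (presented_group ?X {}))"
    using h.inj_iff_trivial_ker by (auto simp: kernel_def)
  then have "h \<in> iso (presented_group ?X {}) (G\<lparr>carrier := ?H\<rparr>)"
    using h(1) im by (auto simp: iso_def hom_def bij_betw_def)
  then have "free_group (G\<lparr>carrier := ?H\<rparr>)" unfolding free_group_def is_iso_def by blast
  then show ?thesis using sub by simp
qed

lemma (in group) word_eval_singleton: "f x \<in> carrier G \<Longrightarrow> word_eval G f [(x, True)] = f x"
  by simp

lemma (in group) free_family_noncommuting: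
  assumes "free_family G f"
  shows "f True \<otimes> f False \<noteq> f False \<otimes> f True"
proof
  assume eq: "f True \<otimes> f False = f False \<otimes> f True"
  have c: "f b \<in> carrier G" for b using assms by (auto simp: free_family_def)
  have "word_eval G f [(True, True), (False, True), (True, False), (False, False)] =
      (f True \<otimes> f False) \<otimes> inv (f False \<otimes> f True)"
    using c by (simp add: inv_mult_group m_assoc)
  also have "\<dots> = \<one>" using c by (simp add: eq)
  finally have "word_eval G f [(True, True), (False, True), (True, False), (False, False)] = \<one>" .
  moreover have "reduced [(True, True), (False, True), (True, False), (False, False)]"
    by (simp add: reduced_def)
  ultimately show False using assms unfolding free_family_def by blast
qed

lemma (in group) not_NF_group:
  fixes f :: "bool \<Rightarrow> 'a"
  assumes "subgroup C G" "free_family G f" "range f \<subseteq> C"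
  shows "\<not> NF_group (G\<lparr>carrier := C\<rparr>)"
proof -
  let ?K = "G\<lparr>carrier := C\<rparr>"
  interpret K: group ?K using assms(1) by (rule subgroup_imp_group)
  have free: "free_family ?K f" using assms by (simp add: free_family_subgroup)
  let ?H = "range (word_eval ?K f)"
  have H: "subgroup ?H ?K" "free_group (?K\<lparr>carrier := ?H\<rparr>)"
    using K.free_group_range_free_family[OF free] by auto
  have fC: "f b \<in> carrier ?K" for b using free by (auto simp: free_family_def)
  have "\<not> comm_group (?K\<lparr>carrier := ?H\<rparr>)"
  proof
    assume "comm_group (?K\<lparr>carrier := ?H\<rparr>)"
    then interpret A: comm_group "?K\<lparr>carrier := ?H\<rparr>" .
    have "word_eval ?K f [(b, True)] = f b" for b
      using K.word_eval_singleton[of f b] fC[of b] by blast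
    then have "f b \<in> ?H" for b by (metis rangeI)
    then show False using A.m_comm[of "f True" "f False"] K.free_family_noncommuting[OF free] by simp
  qed
  then show ?thesis using H unfolding NF_group_def by blast
qed

section \<open>Trees\<close>

text \<open>
  A tree is encoded as a connected graph in which every edge is a wall: some two-colouring of the
  vertices changes across this edge and across no other one.  Each edge is stored with one of its
  two orientations, so that actions preserving \<open>E\<close> are without inversions.
\<close>

locale oriented_tree =
  fixes V :: "'p set" and E :: "('p \<times> 'p) set"
  assumes E_subset: "E \<subseteq> V \<times> V"
    and connected_closed: "\<And>S. S \<subseteq> V \<Longrightarrow> S \<noteq> {} \<Longrightarrow> (\<forall>(a, b)\<in>E. a \<in> S \<longleftrightarrow> b \<in> S) \<Longrightarrow> S = V"
    and ex_wall: "\<And>e. e \<in> E \<Longrightarrow> \<exists>\<sigma> :: 'p \<Rightarrow> bool. \<sigma> (fst e) \<noteq> \<sigma> (snd e) \<and>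
          (\<forall>f\<in>E - {e}. \<sigma> (fst f) = \<sigma> (snd f))"
begin

definition wall :: "'p \<times> 'p \<Rightarrow> ('p \<Rightarrow> bool) \<Rightarrow> bool" where
  "wall e \<sigma> \<longleftrightarrow> \<sigma> (fst e) \<noteq> \<sigma> (snd e) \<and> (\<forall>f\<in>E - {e}. \<sigma> (fst f) = \<sigma> (snd f))"

text \<open>A wall determines its colouring on \<open>V\<close> only up to exchanging the two
  colours (\<open>wall_unique\<close>), so this is an arbitrary choice and only comparisons
  \<open>side e p = side e q\<close> are geometric.\<close>

definition side :: "'p \<times> 'p \<Rightarrow> 'p \<Rightarrow> bool" where
  "side e = (SOME \<sigma>. wall e \<sigma>)"

definition joins :: "'p \<times> 'p \<Rightarrow> 'p \<Rightarrow> 'p \<Rightarrow> bool" where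
  "joins e p q \<longleftrightarrow> e \<in> E \<and> (e = (p, q) \<or> e = (q, p))"

text \<open>These are the edges of the geodesic from \<open>p\<close> to \<open>q\<close>; their
  number is the distance in the tree, used for minimal choices and inductions.\<close>

definition separators :: "'p \<Rightarrow> 'p \<Rightarrow> ('p \<times> 'p) set" where
  "separators p q = {e\<in>E. side e p \<noteq> side e q}"

text \<open>The vertex sets of subtrees, the empty one included.\<close>

definition tree_convex :: "'p set \<Rightarrow> bool" where
  "tree_convex S \<longleftrightarrow> S \<subseteq> V \<and> (\<forall>p\<in>S. \<forall>q\<in>S. \<forall>e\<in>separators p q. fst e \<in> S \<and> snd e \<in> S)"

lemma wall_side: "e \<in> E \<Longrightarrow> wall e (side e)"
  unfolding side_def using ex_wall[of e] by (intro someI_ex[of "wall e"]) (auto simp: wall_def)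

lemma joins_in_V: "joins e p q \<Longrightarrow> p \<in> V \<and> q \<in> V \<and> e \<in> E"
  using E_subset by (auto simp: joins_def)

lemma wall_joins:
  assumes "wall e \<sigma>" "joins f p q"
  shows "\<sigma> p = \<sigma> q \<longleftrightarrow> e \<noteq> f"
proof (cases "f = e")
  case True
  then show ?thesis using assms by (auto simp: wall_def joins_def)
next
  case False
  then have "\<sigma> (fst f) = \<sigma> (snd f)" using assms unfolding wall_def joins_def by blast
  then show ?thesis using False assms(2) by (auto simp: joins_def)
qed

lemma side_joins: "joins e p q \<Longrightarrow> f \<in> E \<Longrightarrow> side f p = side f q \<longleftrightarrow> f \<noteq> e"
  using wall_joins[OF wall_side] by blast

lemma tree_induct [consumes 2, case_names base step]:
  assumes "p \<in> V" "q \<in> V" and "P p"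
    and step: "\<And>e a b. joins e a b \<Longrightarrow> P a \<Longrightarrow> P b"
  shows "P q"
proof -
  have "{r\<in>V. P r} = V"
  proof (rule connected_closed)
    show "\<forall>(a, b)\<in>E. a \<in> {r\<in>V. P r} \<longleftrightarrow> b \<in> {r\<in>V. P r}"
    proof (clarify)
      fix a b assume "(a, b) \<in> E"
      then have "joins (a, b) a b" "joins (a, b) b a" by (auto simp: joins_def)
      then show "a \<in> {r\<in>V. P r} \<longleftrightarrow> b \<in> {r\<in>V. P r}"
        using step joins_in_V by blast
    qed
  qed (use assms in auto)
  then show ?thesis using assms(2) by blast
qed

lemma wall_unique:
  assumes "wall e \<sigma>" "e \<in> E" "p \<in> V" "q \<in> V"
  shows "\<sigma> p = \<sigma> q \<longleftrightarrow> side e p = side e q"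
  using assms(3,4)
proof (induction rule: tree_induct)
  case (step f a b)
  have "side e a = side e b \<longleftrightarrow> e \<noteq> f" using side_joins step assms(2) by blast
  moreover have "\<sigma> a = \<sigma> b \<longleftrightarrow> e \<noteq> f" using wall_joins[OF assms(1) step(1)] .
  ultimately show ?case using step by auto
qed simp

lemma separators_joins:
  assumes "joins f a b"
  shows "separators p b = (separators p a - {f}) \<union> ({f} - separators p a)"
  using side_joins[OF assms] joins_in_V[OF assms] by (auto simp: separators_def)

lemma separators_sym: "separators p q = separators q p"
  by (auto simp: separators_def)

lemma finite_separators:
  assumes "p \<in> V" "q \<in> V"
  shows "finite (separators p q)"
  using assms by (induction rule: tree_induct) (auto simp: separators_def[of p p] separators_joins)

text \<open>Follow a walk from \<open>p\<close>. The edge found for \<open>a\<close> still separates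
  \<open>p\<close> from the next vertex \<open>b\<close> unless this very edge is crossed, and
  crossing it leads back to \<open>p\<close>. From \<open>p\<close> itself, the edge crossed next
  will do.\<close>

lemma ex_first_edge:
  assumes "p \<in> V" "q \<in> V" "p \<noteq> q"
  shows "\<exists>e p'. joins e p p' \<and> side e p \<noteq> side e q"
proof -
  have "q = p \<or> (\<exists>e p'. joins e p p' \<and> side e p \<noteq> side e q)"
    using assms(1,2)
  proof (induction rule: tree_induct)
    case (step f a b)
    show ?case
    proof (cases "a = p")
      case True
      then show ?thesis using step side_joins[of f a b f] joins_in_V by blast
    next
      case False
      then obtain e p' where e: "joins e p p'" "side e p \<noteq> side e a" using step by auto
      have eE: "e \<in> E" using e joins_in_V by blast
      show ?thesis
      proof (cases "e = f")
        case True
        have "side e p \<noteq> side e p'" using side_joins[OF e(1) eE] by simp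
        then have "b = p" using True e step(1) False by (auto simp: joins_def)
        then show ?thesis by simp
      next
        case False
        then have "side e p \<noteq> side e b" using e(2) side_joins[OF step(1) eE] by simp
        then show ?thesis using e(1) by blast
      qed
    qed
  qed simp
  then show ?thesis using assms(3) by auto
qed

lemma separators_first_edge:
  assumes "joins e p p'" "side e p \<noteq> side e q"
  shows "separators p' q = separators p q - {e}" and "e \<in> separators p q"
  using separators_joins[OF assms(1), of q] assms joins_in_V[OF assms(1)]
  by (auto simp: separators_def)

lemma card_separators_first_edge:
  assumes "joins e p p'" "side e p \<noteq> side e q" "q \<in> V"
  shows "card (separators p q) = Suc (card (separators p' q))"
  using separators_first_edge[OF assms(1,2)] finite_separators[of p q] joins_in_V[OF assms(1)] assms(3)
  by (metis card.remove)

text \<open>The side of \<open>f\<close> away from \<open>e\<close> can be entered only through the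
  endpoint \<open>z\<close> of \<open>f\<close>, and it contains neither endpoint of
  \<open>e\<close>. So a walk starting at \<open>z\<close> crosses \<open>e\<close> only outside
  this side and has to come back through \<open>z\<close>.\<close>

lemma same_side_beyond:
  assumes "e \<in> E" "f \<in> E" "e \<noteq> f" "x \<in> V" "y \<in> V"
    and "side f x \<noteq> side f (fst e)" "side f y \<noteq> side f (fst e)"
  shows "side e x = side e y"
proof -
  have le: "joins e (fst e) (snd e)" and lf: "joins f (fst f) (snd f)"
    using assms by (auto simp: joins_def)
  have fe: "side f (fst e) = side f (snd e)" using side_joins[OF le assms(2)] assms(3) by auto
  have ff: "side f (fst f) \<noteq> side f (snd f)" using side_joins[OF lf assms(2)] by auto
  obtain z where z: "z = fst f \<or> z = snd f" "side f z \<noteq> side f (fst e)" using ff by blast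
  have zV: "z \<in> V" using z joins_in_V[OF lf] by auto
  have "side f r = side f (fst e) \<or> side e r = side e z" if "r \<in> V" for r
    using zV that
  proof (induction rule: tree_induct)
    case (step h a b)
    have ha: "side f a = side f b \<longleftrightarrow> f \<noteq> h" "side e a = side e b \<longleftrightarrow> e \<noteq> h"
      using side_joins[OF step(1)] assms by auto
    show ?case
    proof (cases "h = f")
      case True
      then have "b = z \<or> side f b = side f (fst e)" using step(1) z ff by (auto simp: joins_def)
      then show ?thesis by auto
    next
      case False
      show ?thesis
      proof (cases "h = e")
        case True
        then show ?thesis using step(1) fe by (auto simp: joins_def)
      next
        case False
        then show ?thesis using ha \<open>h \<noteq> f\<close> step by auto
      qed
    qed
  qed simp
  then show ?thesis using assms by auto
qed

text \<open>Two distinct walls are nested: the side of \<open>f\<close> away from \<open>e\<close>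
  lies on a single side of \<open>e\<close>, which leaves one quadrant empty.\<close>

lemma no_four_quadrants:
  assumes "e \<in> E" "f \<in> E" "e \<noteq> f" "p \<in> V" "q \<in> V" "r \<in> V" "s \<in> V"
    and "side e p = side e q" "side e r = side e s" "side e p \<noteq> side e r"
    and "side f p = side f r" "side f q = side f s" "side f p \<noteq> side f q"
  shows False
proof (cases "side f p = side f (fst e)")
  case True
  then show False using same_side_beyond[OF assms(1-3), of q s] assms by auto
next
  case False
  then show False using same_side_beyond[OF assms(1-3), of p r] assms by auto
qed

text \<open>Two different first edges would put \<open>p\<close>, \<open>p''\<close>,
  \<open>p'\<close> and \<open>q\<close> into the four quadrants of \<open>e\<close> and
  \<open>f\<close>.\<close>

lemma first_edge_unique:
  assumes "joins e p p'" "joins f p p''" "side e p \<noteq> side e q" "side f p \<noteq> side f q" "q \<in> V"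
  shows "e = f"
proof (rule ccontr)
  assume ne: "e \<noteq> f"
  note l = joins_in_V[OF assms(1)] joins_in_V[OF assms(2)]
  have e: "side e p \<noteq> side e p'" "side e p = side e p''"
    and f: "side f p = side f p'" "side f p \<noteq> side f p''"
    using side_joins[OF assms(1)] side_joins[OF assms(2)] l ne by metis+
  then have "side e p' = side e q" "side f p'' = side f q" using assms(3,4) by auto
  then show False using no_four_quadrants[of e f p p'' p' q] l ne e f assms(5) by blast
qed

lemma tree_convexD:
  assumes "tree_convex S" "p \<in> S" "q \<in> S" "e \<in> E" "side e p \<noteq> side e q"
  shows "fst e \<in> S" "snd e \<in> S"
proof -
  have "e \<in> separators p q" using assms by (simp add: separators_def)
  then show "fst e \<in> S" "snd e \<in> S" using assms(1-3) unfolding tree_convex_def by blast+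
qed

lemma tree_convex_joins:
  assumes "tree_convex S" "p \<in> S" "q \<in> S" "joins e a b" "side e p \<noteq> side e q"
  shows "a \<in> S" "b \<in> S"
proof -
  have "e \<in> E" using joins_in_V[OF assms(4)] by blast
  from tree_convexD[OF assms(1-3) this assms(5)] show "a \<in> S" "b \<in> S"
    using assms(4) by (auto simp: joins_def)
qed

lemma tree_convex_Int: "tree_convex S \<Longrightarrow> tree_convex T \<Longrightarrow> tree_convex (S \<inter> T)"
  unfolding tree_convex_def by blast

text \<open>Choose \<open>a\<close> as close to \<open>b\<close> as possible. The first edge from
  \<open>a\<close> towards \<open>b\<close> stays in \<open>S2\<close>, so by minimality it leaves
  \<open>S1\<close> and cannot separate \<open>a\<close> from \<open>c\<close>. It therefore
  separates \<open>b\<close> from \<open>c\<close>, and convexity of \<open>S3\<close> puts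
  \<open>a\<close> into \<open>S3\<close>.\<close>

lemma helly_three:
  assumes S: "tree_convex S1" "tree_convex S2" "tree_convex S3"
    and "S1 \<inter> S2 \<noteq> {}" "S2 \<inter> S3 \<noteq> {}" "S1 \<inter> S3 \<noteq> {}"
  shows "S1 \<inter> S2 \<inter> S3 \<noteq> {}"
proof -
  obtain b c where b: "b \<in> S2 \<inter> S3" and c: "c \<in> S1 \<inter> S3" using assms by blast
  obtain a where a: "a \<in> S1 \<inter> S2"
    and min: "\<And>a'. a' \<in> S1 \<inter> S2 \<Longrightarrow> card (separators a b) \<le> card (separators a' b)"
    using ex_has_least_nat[of "\<lambda>a. a \<in> S1 \<inter> S2" _ "\<lambda>a. card (separators a b)"] assms(4) by blast
  have V: "a \<in> V" "b \<in> V" using a b S by (auto simp: tree_convex_def)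
  have "a \<in> S3"
  proof (cases "a = b")
    case False
    obtain e a' where e: "joins e a a'" "side e a \<noteq> side e b" using ex_first_edge[OF V False] by blast
    have "a' \<in> S2" using tree_convex_joins[OF S(2) _ _ e] a b by auto
    moreover have "a' \<notin> S1 \<inter> S2" using min[of a'] card_separators_first_edge[OF e V(2)] by auto
    ultimately have "side e a = side e c" using tree_convex_joins[OF S(1) _ _ e(1)] a c by blast
    then show ?thesis using tree_convex_joins[OF S(3) _ _ e(1), of b c] e b c by auto
  qed (use b in auto)
  then show ?thesis using a by blast
qed

lemma helly:
  assumes "finite I" "I \<noteq> {}" "\<And>i. i \<in> I \<Longrightarrow> tree_convex (S i)"
    and "\<And>i j. i \<in> I \<Longrightarrow> j \<in> I \<Longrightarrow> S i \<inter> S j \<noteq> {}"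
  shows "(\<Inter>i\<in>I. S i) \<noteq> {}"
  using assms
proof (induction I arbitrary: S rule: finite_ne_induct)
  case (insert i I)
  have "(\<Inter>j\<in>I. S j \<inter> S i) \<noteq> {}"
  proof (rule insert.IH)
    fix j k assume jk: "j \<in> I" "k \<in> I"
    show "tree_convex (S j \<inter> S i)" using jk insert.prems by (intro tree_convex_Int) auto
    have "S j \<inter> S k \<inter> S i \<noteq> {}" using jk insert.prems by (intro helly_three) auto
    then show "(S j \<inter> S i) \<inter> (S k \<inter> S i) \<noteq> {}" by blast
  qed
  moreover have "(\<Inter>j\<in>I. S j \<inter> S i) \<subseteq> (\<Inter>j\<in>insert i I. S j)" using insert.hyps(2) by blast
  ultimately show ?case by blast
qed auto

end

section \<open>Groups acting on trees\<close>

locale tree_action = group G + oriented_tree V E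
  for G :: "('a, 'm) monoid_scheme" (structure) and V :: "'p set" and E +
  fixes act :: "'a \<Rightarrow> 'p \<Rightarrow> 'p"
  assumes act_closed: "g \<in> carrier G \<Longrightarrow> p \<in> V \<Longrightarrow> act g p \<in> V"
    and act_one: "p \<in> V \<Longrightarrow> act \<one> p = p"
    and act_mult: "g \<in> carrier G \<Longrightarrow> h \<in> carrier G \<Longrightarrow> p \<in> V \<Longrightarrow> act (g \<otimes> h) p = act g (act h p)"
    and act_edge: "g \<in> carrier G \<Longrightarrow> (p, q) \<in> E \<Longrightarrow> (act g p, act g q) \<in> E"
begin

abbreviation act2 :: "'a \<Rightarrow> 'p \<times> 'p \<Rightarrow> 'p \<times> 'p" where
  "act2 g \<equiv> map_prod (act g) (act g)"

definition fixed :: "'a \<Rightarrow> 'p set" where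
  "fixed g = {p\<in>V. act g p = p}"

lemma act_inv_left: "g \<in> carrier G \<Longrightarrow> p \<in> V \<Longrightarrow> act (inv g) (act g p) = p"
  using act_mult[of "inv g" g p] act_one by simp

lemma act_inv_right: "g \<in> carrier G \<Longrightarrow> p \<in> V \<Longrightarrow> act g (act (inv g) p) = p"
  using act_mult[of g "inv g" p] act_one by simp

lemma act_eq_iff: "g \<in> carrier G \<Longrightarrow> p \<in> V \<Longrightarrow> q \<in> V \<Longrightarrow> act g p = act g q \<longleftrightarrow> p = q"
  by (metis act_inv_left)

lemma act2_in_E: "g \<in> carrier G \<Longrightarrow> e \<in> E \<Longrightarrow> act2 g e \<in> E"
  by (cases e) (auto intro: act_edge)

lemma act2_inv:
  assumes "g \<in> carrier G" "e \<in> E"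
  shows "act2 g (act2 (inv g) e) = e"
  using assms E_subset by (cases e) (auto simp: act_inv_right)

lemma joins_act: "joins e p q \<Longrightarrow> g \<in> carrier G \<Longrightarrow> joins (act2 g e) (act g p) (act g q)"
  using act2_in_E by (auto simp: joins_def)

lemma wall_act:
  assumes "g \<in> carrier G" "e \<in> E"
  shows "wall (act2 g e) (\<lambda>p. side e (act (inv g) p))"
proof -
  have "side e (act (inv g) (fst (act2 g e))) \<noteq> side e (act (inv g) (snd (act2 g e)))"
    using wall_side[OF assms(2)] assms E_subset by (cases e) (auto simp: wall_def act_inv_left)
  moreover have "side e (act (inv g) (fst f)) = side e (act (inv g) (snd f))"
    if "f \<in> E" "f \<noteq> act2 g e" for f
  proof -
    have "act2 (inv g) f \<in> E" using that assms act2_in_E[of "inv g" f] by simp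
    moreover have "act2 (inv g) f \<noteq> e" using that act2_inv[OF assms(1) that(1)] by metis
    ultimately have "act2 (inv g) f \<in> E - {e}" by simp
    then have "side e (fst (act2 (inv g) f)) = side e (snd (act2 (inv g) f))"
      using wall_side[OF assms(2)] unfolding wall_def by blast
    then show ?thesis by (cases f) simp
  qed
  ultimately show ?thesis by (simp add: wall_def)
qed

lemma side_act:
  assumes "g \<in> carrier G" "e \<in> E" "p \<in> V" "q \<in> V"
  shows "side (act2 g e) (act g p) = side (act2 g e) (act g q) \<longleftrightarrow> side e p = side e q"
  using wall_unique[OF wall_act[OF assms(1,2)] act2_in_E[OF assms(1,2)], of "act g p" "act g q"] assms
  by (simp add: act_closed act_inv_left)

text \<open>The image of the first edge from \<open>p\<close> to \<open>q\<close> is again such an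
  edge, and there is only one.\<close>

lemma fixed_first_edge:
  assumes "g \<in> carrier G" "p \<in> fixed g" "q \<in> fixed g" "joins e p p'" "side e p \<noteq> side e q"
  shows "act2 g e = e" "p' \<in> fixed g"
proof -
  have V: "p \<in> V" "q \<in> V" and eq: "act g p = p" "act g q = q" using assms by (auto simp: fixed_def)
  have eE: "e \<in> E" "p' \<in> V" using joins_in_V[OF assms(4)] by auto
  have l: "joins (act2 g e) p (act g p')" using joins_act[OF assms(4,1)] eq by simp
  show e: "act2 g e = e"
    using first_edge_unique[OF l assms(4) _ assms(5) V(2)] side_act[OF assms(1) eE(1) V] assms(5) eq by simp
  then show "p' \<in> fixed g" using assms(4) eq eE by (cases e) (auto simp: fixed_def joins_def)
qed

lemma tree_convex_fixed:
  assumes "g \<in> carrier G"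
  shows "tree_convex (fixed g)"
proof -
  have "fst e \<in> fixed g \<and> snd e \<in> fixed g"
    if "p \<in> fixed g" "q \<in> fixed g" "e \<in> separators p q" for p q e
    using that
  proof (induction "card (separators p q)" arbitrary: p)
    case 0
    then show ?case using finite_separators[of p q] by (auto simp: fixed_def)
  next
    case (Suc n)
    then have V: "p \<in> V" "q \<in> V" and "p \<noteq> q" by (auto simp: fixed_def separators_def)
    then obtain f p' where f: "joins f p p'" "side f p \<noteq> side f q" using ex_first_edge by blast
    note f' = fixed_first_edge[OF assms Suc.prems(1,2) f]
    have n: "n = card (separators p' q)" using card_separators_first_edge[OF f V(2)] Suc by simp
    show ?case
    proof (cases "e = f")
      case True
      then show ?thesis using f f' Suc.prems(1) by (auto simp: joins_def)
    next
      case False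
      then show ?thesis using Suc.hyps(1)[OF n f'(2) Suc.prems(2)] separators_first_edge[OF f] Suc.prems by blast
    qed
  qed
  then show ?thesis by (auto simp: tree_convex_def fixed_def)
qed

lemma fixed_edge_iff:
  assumes "g \<in> carrier G" "e \<in> E"
  shows "act2 g e = e \<longleftrightarrow> fst e \<in> fixed g \<and> snd e \<in> fixed g"
  using assms E_subset by (cases e) (auto simp: fixed_def)

text \<open>For \<open>p\<close> and \<open>q\<close> at minimal positive distance, the first edge
  \<open>f\<close> from \<open>q\<close> to \<open>p\<close> is not fixed by \<open>y\<close>. It
  separates \<open>p\<close> from \<open>act y p\<close>: otherwise \<open>act2 (inv y) f\<close>
  would also be a first edge from \<open>q\<close> to \<open>p\<close>, hence equal to
  \<open>f\<close>. As \<open>x\<close> and \<open>y\<close> commute, \<open>x\<close> fixes both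
  \<open>p\<close> and \<open>act y p\<close>, and by convexity also \<open>q\<close>.\<close>

lemma commuting_fixed_Int:
  assumes "x \<in> carrier G" "y \<in> carrier G" "x \<otimes> y = y \<otimes> x" "fixed x \<noteq> {}" "fixed y \<noteq> {}"
  shows "fixed x \<inter> fixed y \<noteq> {}"
proof -
  obtain p0 q0 where "p0 \<in> fixed x" "q0 \<in> fixed y" using assms by blast
  then obtain p q where p: "p \<in> fixed x" and q: "q \<in> fixed y"
    and min: "\<And>p' q'. p' \<in> fixed x \<Longrightarrow> q' \<in> fixed y \<Longrightarrow> card (separators p q) \<le> card (separators p' q')"
    using ex_has_least_nat[of "\<lambda>(p, q). p \<in> fixed x \<and> q \<in> fixed y" "(p0, q0)"
        "\<lambda>(p, q). card (separators p q)"] by auto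
  have V: "p \<in> V" "q \<in> V" using p q by (auto simp: fixed_def)
  show ?thesis
  proof (cases "p = q")
    case False
    obtain f q' where f: "joins f q q'" "side f q \<noteq> side f p" using ex_first_edge[OF V(2,1)] False by blast
    have q'y: "q' \<notin> fixed y"
      using card_separators_first_edge[OF f V(1)] min[OF p, of q'] by (auto simp: separators_sym[of p])
    have fV: "q' \<in> V" "f \<in> E" using joins_in_V[OF f(1)] by auto
    have yp: "act y p \<in> fixed x"
      using p assms V by (auto simp: fixed_def act_closed) (metis act_mult)
    have "side f (act y p) = side f q"
    proof (rule ccontr)
      assume ne: "side f (act y p) \<noteq> side f q"
      have iy: "act (inv y) q = q" using q assms(2) by (auto simp: fixed_def) (metis act_inv_left)
      have "side (act2 (inv y) f) q \<noteq> side (act2 (inv y) f) p"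
        using side_act[of "inv y" f q "act y p"] ne fV V assms(2) iy
        by (auto simp: act_closed act_inv_left)
      moreover have l: "joins (act2 (inv y) f) q (act (inv y) q')"
        using joins_act[OF f(1), of "inv y"] assms(2) iy by simp
      ultimately have eq: "act2 (inv y) f = f" using first_edge_unique[OF _ f(1) _ f(2) V(1)] by blast
      then have "act2 y f = f" using act2_inv[OF assms(2) fV(2)] by simp
      then show False using q'y f(1) fixed_edge_iff[OF assms(2) fV(2)] by (auto simp: joins_def)
    qed
    then have "q \<in> fixed x"
      using tree_convex_joins[OF tree_convex_fixed[OF assms(1)] p yp f(1)] f(2) by auto
    then show ?thesis using q by blast
  qed (use p q in blast)
qed

section \<open>Half-spaces and their translates\<close>

definition halfspace :: "'p set \<Rightarrow> bool" where
  "halfspace H \<longleftrightarrow> (\<exists>e\<in>E. \<exists>b. H = {p\<in>V. side e p = b})"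

lemma finite_halfspaces:
  assumes "p \<in> V" "q \<in> V"
  shows "finite {H. halfspace H \<and> p \<in> H \<and> q \<notin> H}"
proof (rule finite_subset)
  show "{H. halfspace H \<and> p \<in> H \<and> q \<notin> H} \<subseteq> (\<lambda>e. {r\<in>V. side e r = side e p}) ` separators p q"
    using assms(2) by (auto simp: halfspace_def separators_def)
  show "finite ((\<lambda>e. {r\<in>V. side e r = side e p}) ` separators p q)"
    using finite_separators[OF assms] by simp
qed

lemma halfspace_nonempty:
  assumes "halfspace H"
  shows "H \<subseteq> V" "H \<noteq> {}" "H \<noteq> V"
proof -
  obtain e b where e: "e \<in> E" "H = {p\<in>V. side e p = b}" using assms by (auto simp: halfspace_def)
  have "joins e (fst e) (snd e)" using e by (auto simp: joins_def)
  from side_joins[OF this e(1)] joins_in_V[OF this]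
  have "side e (fst e) \<noteq> side e (snd e)" "fst e \<in> V" "snd e \<in> V" by auto
  then show "H \<subseteq> V" "H \<noteq> {}" "H \<noteq> V" using e(2) by auto
qed

lemma act_image_mult:
  "g \<in> carrier G \<Longrightarrow> h \<in> carrier G \<Longrightarrow> H \<subseteq> V \<Longrightarrow> act (g \<otimes> h) ` H = act g ` act h ` H"
  by (auto simp: image_image act_mult subset_iff)

lemma act_image_one: "H \<subseteq> V \<Longrightarrow> act \<one> ` H = H"
  by (auto simp: act_one subset_iff image_iff)

lemma act_image_subset: "g \<in> carrier G \<Longrightarrow> H \<subseteq> V \<Longrightarrow> act g ` H \<subseteq> V"
  by (auto simp: act_closed)

lemma act_image_psubset:
  assumes "g \<in> carrier G" "H \<subset> K" "K \<subseteq> V"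
  shows "act g ` H \<subset> act g ` K"
proof -
  have "inj_on (act g) K" using assms(1,3) act_eq_iff by (intro inj_onI) blast
  then show ?thesis using assms(2) by (metis image_strict_mono)
qed

lemma mem_act_image:
  assumes "g \<in> carrier G" "H \<subseteq> V" "p \<in> V"
  shows "p \<in> act g ` H \<longleftrightarrow> act (inv g) p \<in> H"
  using assms by (auto simp: act_inv_left subset_iff) (metis act_inv_right imageI)

lemma act_image_side:
  assumes "g \<in> carrier G" "e \<in> E" "c \<in> V"
  shows "act g ` {p\<in>V. side e p = side e c} = {p\<in>V. side (act2 g e) p = side (act2 g e) (act g c)}"
proof (intro equalityI subsetI)
  fix p assume "p \<in> {p\<in>V. side (act2 g e) p = side (act2 g e) (act g c)}"
  then have p: "p \<in> V" "side (act2 g e) p = side (act2 g e) (act g c)" by auto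
  then have "side e (act (inv g) p) = side e c"
    using side_act[OF assms(1,2) _ assms(3), of "act (inv g) p"] assms(1)
    by (simp add: act_closed act_inv_right)
  then show "p \<in> act g ` {p\<in>V. side e p = side e c}" using p assms by (simp add: mem_act_image act_closed)
next
  fix p assume "p \<in> act g ` {p\<in>V. side e p = side e c}"
  then obtain r where r: "r \<in> V" "side e r = side e c" "p = act g r" by blast
  then have "side (act2 g e) p = side (act2 g e) (act g c)" using side_act[OF assms(1,2) r(1) assms(3)] by simp
  then show "p \<in> {p\<in>V. side (act2 g e) p = side (act2 g e) (act g c)}"
    using r assms(1) by (simp add: act_closed)
qed

lemma halfspace_act:
  assumes "g \<in> carrier G" "halfspace H"
  shows "halfspace (act g ` H)"
proof -
  obtain e b where e: "e \<in> E" "H = {p\<in>V. side e p = b}" using assms by (auto simp: halfspace_def)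
  obtain c where "c \<in> V" "side e c = b" using halfspace_nonempty[OF assms(2)] e by blast
  then have "act g ` H = {p\<in>V. side (act2 g e) p = side (act2 g e) (act g c)}"
    using act_image_side[OF assms(1) e(1)] e(2) by blast
  then show ?thesis using act2_in_E[OF assms(1) e(1)] by (auto simp: halfspace_def)
qed

text \<open>For \<open>p\<close> of minimal displacement, the geodesic from \<open>p\<close> to
  \<open>act x p\<close> cannot begin with \<open>e\<close> and end with the image of
  \<open>e\<close>, since then the displacement of \<open>p1\<close> would be smaller by two. So the
  image of \<open>e\<close> does not separate \<open>p\<close> from \<open>act x p\<close>, and
  nesting of walls makes \<open>x\<close> shrink the side of \<open>e\<close> containing
  \<open>act x p\<close>.\<close>

lemma hyperbolic_halfspace:
  assumes x: "x \<in> carrier G" "fixed x = {}" "V \<noteq> {}"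
  obtains H where "halfspace H" "act x ` H \<subset> H"
proof -
  obtain p0 where "p0 \<in> V" using x by blast
  then obtain p where p: "p \<in> V"
    and min: "\<And>p'. p' \<in> V \<Longrightarrow> card (separators p (act x p)) \<le> card (separators p' (act x p'))"
    using ex_has_least_nat[of "\<lambda>p. p \<in> V" p0 "\<lambda>p. card (separators p (act x p))"] by blast
  let ?q = "act x p"
  have q: "?q \<in> V" "p \<noteq> ?q" using p x by (auto simp: act_closed fixed_def)
  obtain e p1 where e: "joins e p p1" "side e p \<noteq> side e ?q" using ex_first_edge[OF p q] by blast
  have eE: "e \<in> E" "p1 \<in> V" using joins_in_V[OF e(1)] by auto
  let ?e = "act2 x e" and ?q1 = "act x p1"
  have le: "joins ?e ?q ?q1" using joins_act[OF e(1) x(1)] .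
  have xe: "?e \<in> E" "?q1 \<in> V" using joins_in_V[OF le] by auto
  \<comment> \<open>Orientations are preserved, so an edge equal to its image would have fixed
    endpoints.\<close>
  have ne: "e \<noteq> ?e" using e(1) q(2) by (cases e) (auto simp: joins_def)
  have d1: "card (separators p ?q) = Suc (card (separators p1 ?q))"
    using card_separators_first_edge[OF e q(1)] .
  have same: "side ?e p = side ?e ?q"
  proof (rule ccontr)
    assume a: "side ?e p \<noteq> side ?e ?q"
    then have "side ?e ?q \<noteq> side ?e p1" using side_joins[OF e(1) xe(1)] ne by auto
    from card_separators_first_edge[OF le this eE(2)]
    have "card (separators ?q p1) = Suc (card (separators ?q1 p1))" .
    then show False using d1 min[OF eE(2)] by (simp add: separators_sym[of ?q] separators_sym[of ?q1])
  qed
  let ?H = "{r\<in>V. side e r = side e ?q}"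
  have img: "act x ` ?H = {r\<in>V. side ?e r \<noteq> side ?e ?q}"
  proof -
    have "side e p1 = side e ?q" using side_joins[OF e(1) eE(1)] e(2) by auto
    then have "act x ` ?H = {r\<in>V. side ?e r = side ?e ?q1}"
      using act_image_side[OF x(1) eE] by simp
    then show ?thesis using side_joins[OF le xe(1)] by auto
  qed
  have "act x ` ?H \<subseteq> ?H"
  proof (rule ccontr)
    assume "\<not> ?thesis"
    then obtain r where r: "r \<in> V" "side ?e r \<noteq> side ?e ?q" "side e r \<noteq> side e ?q" unfolding img by blast
    have "side e ?q1 = side e ?q" using side_joins[OF le eE(1)] ne by auto
    moreover have "side ?e ?q1 \<noteq> side ?e ?q" using side_joins[OF le xe(1)] by auto
    ultimately show False
      using no_four_quadrants[OF eE(1) xe(1) ne p r(1) q(1) xe(2)] r same e(2) by auto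
  qed
  moreover have "?q \<in> ?H" "?q \<notin> act x ` ?H" using q img by auto
  ultimately have "act x ` ?H \<subset> ?H" by blast
  moreover have "halfspace ?H" using eE by (auto simp: halfspace_def)
  ultimately show thesis using that by blast
qed

lemma infinite_descending_halfspaces:
  assumes g: "g \<in> carrier G" and H: "H \<subseteq> V" "act g ` H \<subset> H"
  shows "inj (\<lambda>n :: nat. act (g [^] n) ` H)" "act (g [^] (n :: nat)) ` H \<subseteq> H"
proof -
  have "act (g [^] Suc n) ` H \<subset> act (g [^] n) ` H" for n :: nat
    using act_image_psubset[of "g [^] n" "act g ` H" H] g H by (simp add: act_image_mult)
  then have *: "act (g [^] n) ` H \<subset> act (g [^] m) ` H" if "m < n" for m n :: nat
    using lift_Suc_mono_less[of "\<lambda>n. - act (g [^] n) ` H" m n] that by auto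
  show "inj (\<lambda>n :: nat. act (g [^] n) ` H)" 
  proof (rule linorder_injI)
    fix m n :: nat assume "m < n"
    then show "act (g [^] m) ` H \<noteq> act (g [^] n) ` H" using *[of m n] by blast
  qed
  show "act (g [^] n) ` H \<subseteq> H" using *[of 0 n] act_image_one[OF H(1)] by (cases n) auto
qed

text \<open>
  Up to translation by powers of \<open>x\<close>, the half-spaces shrunk by \<open>x\<close> are among the finitely many
  ones separating \<open>p\<close> from its translate.
\<close>

lemma halfspace_switch:
  assumes x: "x \<in> carrier G" and H: "halfspace H" "act x ` H \<subset> H" and p: "p \<in> V"
  shows "\<exists>k :: int. p \<in> act (x [^] k) ` H \<and> act (inv x) p \<notin> act (x [^] k) ` H"
proof -
  note HV = halfspace_nonempty[OF H(1)]
  obtain r q where r: "r \<in> H" and q: "q \<in> V" "q \<notin> H" using HV by blast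
  \<comment> \<open>Otherwise infinitely many translates of \<open>H\<close> would separate
    \<open>p\<close> from \<open>q\<close>. The powers of \<open>inv x\<close>, which enlarge
    \<open>H\<close>, are treated in the same way with \<open>r\<close> and
    \<open>p\<close>.\<close>
  have "\<exists>n :: nat. p \<notin> act (x [^] n) ` H"
  proof (rule ccontr)
    assume "\<nexists>n :: nat. p \<notin> act (x [^] n) ` H"
    then have "range (\<lambda>n :: nat. act (x [^] n) ` H) \<subseteq> {K. halfspace K \<and> p \<in> K \<and> q \<notin> K}"
      using infinite_descending_halfspaces(2)[OF x HV(1) H(2)] q halfspace_act[OF _ H(1)] x by blast
    then show False
      using finite_halfspaces[OF p q(1)] infinite_descending_halfspaces(1)[OF x HV(1) H(2)]
        finite_subset range_inj_infinite by blast
  qed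
  then obtain n :: nat where n: "p \<notin> act (x [^] n) ` H" by blast
  have "\<exists>m :: nat. act (x [^] m) p \<in> H"
  proof (rule ccontr)
    assume "\<nexists>m :: nat. act (x [^] m) p \<in> H"
    have iH: "H \<subset> act (inv x) ` H"
      using act_image_psubset[OF inv_closed[OF x] H(2) HV(1)] x act_image_mult[of "inv x" x H]
        act_image_one[OF HV(1)] HV(1) by simp
    define K where "K n = act (inv x [^] n) ` H" for n :: nat
    have K: "K n \<subset> K (Suc n)" for n
      using act_image_psubset[of "inv x [^] n" H "act (inv x) ` H"] iH x HV(1)
      by (simp add: K_def act_image_mult act_image_subset)
    have mono: "K m \<subset> K n" if "m < n" for m n using lift_Suc_mono_less[of K] K that by blast
    have "inj K"
    proof (rule linorder_injI)
      fix m n :: nat assume "m < n"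
      then show "K m \<noteq> K n" using mono[of m n] by blast
    qed
    moreover have "r \<in> K n" for n
      using mono[of 0 n] r act_image_one[OF HV(1)] by (cases n) (auto simp: K_def)
    moreover have "p \<notin> K n" for n
      using \<open>\<nexists>m. _ m\<close> mem_act_image[of "inv x [^] n" H p] x HV(1) p
      by (auto simp: K_def nat_pow_inv)
    moreover have "halfspace (K n)" for n using halfspace_act[OF _ H(1)] x by (simp add: K_def)
    ultimately have "range K \<subseteq> {K. halfspace K \<and> r \<in> K \<and> p \<notin> K}" by blast
    then show False
      using finite_halfspaces[of r p] r p HV(1) \<open>inj K\<close> finite_subset range_inj_infinite by blast
  qed
  then obtain m :: nat where m: "act (x [^] m) p \<in> H" by blast
  \<comment> \<open>\<open>P\<close> holds at \<open>- int m\<close> and fails at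
    \<open>int n\<close>, so it switches from true to false between some \<open>k\<close> and
    \<open>k + 1\<close>. Failure at \<open>k + 1\<close> says that \<open>act (inv x) p\<close> is
    outside the \<open>k\<close>-th translate.\<close>
  define P where "P k \<longleftrightarrow> p \<in> act (x [^] k) ` H" for k :: int
  have "P (- int m)"
    using m x HV(1) p by (simp add: P_def mem_act_image int_pow_neg int_pow_int)
  moreover have "\<not> P (int n)" using n by (simp add: P_def int_pow_int)
  moreover have "P (- int m + int j)" if "P (- int m)" "\<forall>k. P k \<longrightarrow> P (k + 1)" for j :: nat
    using that by (induction j) (auto simp: algebra_simps)
  from this[of "m + n"] have "\<forall>k. P k \<longrightarrow> P (k + 1) \<Longrightarrow> P (- int m) \<Longrightarrow> P (int n)" by simp
  ultimately obtain k where k: "P k" "\<not> P (k + 1)" by blast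
  have "x [^] (k + 1) = x \<otimes> x [^] k"
    using x int_pow_mult[of x 1 k] by (simp add: add.commute)
  then have "act (x [^] (k + 1)) ` H = act x ` act (x [^] k) ` H"
    using x HV(1) by (simp add: act_image_mult)
  then have "act (inv x) p \<notin> act (x [^] k) ` H"
    using k(2) x p mem_act_image[of x "act (x [^] k) ` H" p] act_image_subset[of "x [^] k" H] HV(1)
    by (simp add: P_def)
  then show ?thesis using k(1) by (auto simp: P_def)
qed

end

section \<open>Centralizers of hyperbolic elements\<close>

context group
begin

lemma commute_mult:
  assumes "g \<in> carrier G" "h \<in> carrier G" "x \<in> carrier G" "g \<otimes> x = x \<otimes> g" "h \<otimes> x = x \<otimes> h"
  shows "(g \<otimes> h) \<otimes> x = x \<otimes> (g \<otimes> h)"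
  using assms by (metis m_assoc)

lemma commute_inv:
  assumes "g \<in> carrier G" "x \<in> carrier G" "g \<otimes> x = x \<otimes> g"
  shows "inv g \<otimes> x = x \<otimes> inv g"
  using assms by (metis inv_closed inv_solve_left inv_solve_right m_assoc m_closed)

lemma commute_nat_pow:
  assumes "g \<in> carrier G" "x \<in> carrier G" "g \<otimes> x = x \<otimes> g"
  shows "g [^] (n :: nat) \<otimes> x = x \<otimes> g [^] n"
  using assms by (induction n) (auto intro: commute_mult)

lemma commute_int_pow:
  assumes "g \<in> carrier G" "x \<in> carrier G" "g \<otimes> x = x \<otimes> g"
  shows "g [^] (k :: int) \<otimes> x = x \<otimes> g [^] k"
proof (cases "k < 0")
  case True
  have "inv (g [^] nat (- k)) \<otimes> x = x \<otimes> inv (g [^] nat (- k))"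
    by (rule commute_inv[OF nat_pow_closed[OF assms(1)] assms(2) commute_nat_pow[OF assms]])
  then show ?thesis by (simp only: int_pow_def2 True if_True)
next
  case False
  then show ?thesis by (simp only: int_pow_def2 if_False commute_nat_pow[OF assms])
qed

end

context tree_action
begin

lemma act_image_cancel:
  assumes "g \<in> carrier G" "A \<subseteq> V" "B \<subseteq> V" "act g ` A = act g ` B"
  shows "A = B"
proof -
  have "act (inv g) ` act g ` C = C" if "C \<subseteq> V" for C
    using act_image_mult[of "inv g" g C] act_image_one assms(1) that by simp
  then show ?thesis using assms by metis
qed

text \<open>For \<open>H\<close> shrunk by \<open>x\<close>, the number \<open>k\<close> measures
  the translation of \<open>g\<close> along the axis of \<open>x\<close>, in units of that of
  \<open>x\<close>. An element of the centralizer may have such an integer only after passing to a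
  power.\<close>

definition shifts :: "'a \<Rightarrow> 'p set \<Rightarrow> 'a \<Rightarrow> int \<Rightarrow> bool" where
  "shifts x H g k \<longleftrightarrow> g \<in> carrier G \<and> g \<otimes> x = x \<otimes> g \<and> act g ` H = act (x [^] k) ` H"

lemma shifts_mult:
  assumes "x \<in> carrier G" "H \<subseteq> V" "shifts x H g k" "shifts x H h l"
  shows "shifts x H (g \<otimes> h) (k + l)"
proof -
  have g: "g \<in> carrier G" "g \<otimes> x = x \<otimes> g" "act g ` H = act (x [^] k) ` H"
    and h: "h \<in> carrier G" "h \<otimes> x = x \<otimes> h" "act h ` H = act (x [^] l) ` H"
    using assms by (auto simp: shifts_def)
  have "act (g \<otimes> h) ` H = act (g \<otimes> x [^] l) ` H"
    using g h assms by (simp add: act_image_mult)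
  also have "g \<otimes> x [^] l = x [^] l \<otimes> g" using commute_int_pow[of x g l] assms(1) g by simp
  also have "act (x [^] l \<otimes> g) ` H = act (x [^] l \<otimes> x [^] k) ` H"
    using g assms by (simp add: act_image_mult)
  also have "x [^] l \<otimes> x [^] k = x [^] (k + l)" using int_pow_mult[OF assms(1), of l k] by (simp add: add.commute)
  finally show ?thesis using g h assms(1) by (simp add: shifts_def commute_mult)
qed

lemma shifts_inv:
  assumes "x \<in> carrier G" "H \<subseteq> V" "shifts x H g k"
  shows "shifts x H (inv g) (- k)"
proof -
  have g: "g \<in> carrier G" "g \<otimes> x = x \<otimes> g" "act g ` H = act (x [^] k) ` H"
    using assms by (auto simp: shifts_def)
  have "act g ` act (x [^] (- k)) ` H = act (x [^] (- k) \<otimes> g) ` H"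
    using commute_int_pow[of x g "- k"] assms(1,2) g by (simp add: act_image_mult)
  also have "\<dots> = act (x [^] (- k) \<otimes> x [^] k) ` H" using g assms by (simp add: act_image_mult)
  also have "\<dots> = act g ` act (inv g) ` H"
    using g assms by (simp add: int_pow_neg act_image_mult[symmetric])
  finally have "act (inv g) ` H = act (x [^] (- k)) ` H"
    using act_image_cancel[OF g(1), of "act (inv g) ` H" "act (x [^] (- k)) ` H"] g(1) assms(1,2)
    by (simp add: act_image_subset)
  then show ?thesis using g assms(1) by (simp add: shifts_def commute_inv)
qed

lemma shifts_nat_pow:
  assumes "x \<in> carrier G" "H \<subseteq> V" "shifts x H g k"
  shows "\<exists>l. shifts x H (g [^] (n :: nat)) l"
proof (induction n)
  case 0
  then show ?case using assms(1) by (intro exI[of _ 0]) (simp add: shifts_def)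
next
  case (Suc n)
  then show ?case using shifts_mult[OF assms(1,2) _ assms(3)] by (metis nat_pow_Suc)
qed

lemma shifts_commutator:
  assumes "x \<in> carrier G" "H \<subseteq> V" "shifts x H g k" "shifts x H h l"
  shows "act (g \<otimes> h \<otimes> inv g \<otimes> inv h) ` H = H"
proof -
  have "shifts x H (g \<otimes> h \<otimes> inv g \<otimes> inv h) (k + l + - k + - l)"
    using assms by (intro shifts_mult shifts_inv)
  then show ?thesis using act_image_one[OF assms(2)] by (simp add: shifts_def)
qed

text \<open>Since \<open>y\<close> commutes with \<open>x\<close>, all half-spaces y^i H are shrunk
  by \<open>x\<close>, so powers of \<open>x\<close> move them into the finite set of half-spaces
  that contain \<open>p\<close> but not \<open>act (inv x) p\<close>. Two of these translates
  coincide, and the difference of their indices is the exponent sought.\<close>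

lemma ex_power_shifts:
  assumes x: "x \<in> carrier G" and H: "halfspace H" "act x ` H \<subset> H"
    and y: "y \<in> carrier G" "y \<otimes> x = x \<otimes> y"
  shows "\<exists>m > 0. \<exists>k. shifts x H (y [^] (m :: nat)) k"
proof -
  note HV = halfspace_nonempty[OF H(1)]
  obtain p where p: "p \<in> V" using HV by blast
  let ?H = "\<lambda>i :: nat. act (y [^] i) ` H"
  have sw: "\<exists>k :: int. p \<in> act (x [^] k) ` ?H i \<and> act (inv x) p \<notin> act (x [^] k) ` ?H i" for i
  proof (rule halfspace_switch[OF x _ _ p])
    show "halfspace (?H i)" using halfspace_act[OF _ H(1)] y by simp
    have "act x ` ?H i = act (y [^] i) ` act x ` H"
      using commute_nat_pow[OF y(1) x y(2), of i] x y(1) HV(1) by (simp add: act_image_mult[symmetric])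
    then show "act x ` ?H i \<subset> ?H i" using act_image_psubset[of "y [^] i", OF _ H(2) HV(1)] y(1) by simp
  qed
  then obtain k :: "nat \<Rightarrow> int" where
    k: "\<And>i. p \<in> act (x [^] k i) ` ?H i \<and> act (inv x) p \<notin> act (x [^] k i) ` ?H i" by metis
  let ?K = "\<lambda>i. act (x [^] k i) ` ?H i"
  have "range ?K \<subseteq> {K. halfspace K \<and> p \<in> K \<and> act (inv x) p \<notin> K}"
    using k halfspace_act H(1) x y(1) by blast
  moreover have "finite {K. halfspace K \<and> p \<in> K \<and> act (inv x) p \<notin> K}"
    using finite_halfspaces[OF p] x p by (simp add: act_closed)
  ultimately have "\<not> inj ?K" using finite_subset range_inj_infinite by blast
  then obtain i j where ij: "i < j" "?K i = ?K j"
    by (metis (no_types, lifting) linorder_injI)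
  define m where "m = j - i"
  have c: "x [^] k n \<otimes> y [^] i = y [^] i \<otimes> x [^] k n" for n
    using commute_int_pow[OF x _ commute_nat_pow[OF y(1) x y(2), of i, symmetric], of "k n"] y(1) by simp
  have "?K i = act (y [^] i) ` act (x [^] k i) ` H"
    using c[of i] x y(1) HV(1) by (simp add: act_image_mult[symmetric])
  moreover have "?K j = act (y [^] i) ` act (x [^] k j) ` act (y [^] m) ` H"
  proof -
    have "y [^] j = y [^] i \<otimes> y [^] m" using ij y(1) by (simp add: m_def nat_pow_mult)
    then have "?K j = act (x [^] k j \<otimes> y [^] i) ` act (y [^] m) ` H"
      using x y(1) HV(1) by (simp add: act_image_mult act_image_subset)
    also have "\<dots> = act (y [^] i) ` act (x [^] k j) ` act (y [^] m) ` H"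
      unfolding c using x y(1) HV(1) by (simp add: act_image_mult act_image_subset)
    finally show ?thesis .
  qed
  ultimately have "act (x [^] k i) ` H = act (x [^] k j) ` act (y [^] m) ` H"
    using ij(2) act_image_cancel[of "y [^] i" "act (x [^] k i) ` H" "act (x [^] k j) ` act (y [^] m) ` H"]
      x y(1) HV(1) by (simp add: act_image_subset)
  then have "act (inv (x [^] k j)) ` act (x [^] k i) ` H = act (inv (x [^] k j)) ` act (x [^] k j) ` act (y [^] m) ` H"
    by simp
  also have "\<dots> = act (y [^] m) ` H"
    using x y(1) HV(1) act_image_mult[of "inv (x [^] k j)" "x [^] k j" "act (y [^] m) ` H"]
      act_image_one[of "act (y [^] m) ` H"] by (simp add: act_image_subset)
  finally have "act (y [^] m) ` H = act (x [^] (- k j + k i)) ` H"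
    using x HV(1) int_pow_mult[OF x, of "- k j" "k i"] by (simp add: act_image_mult int_pow_neg)
  then have "shifts x H (y [^] m) (- k j + k i)"
    using commute_nat_pow[OF y(1) x y(2)] y(1) by (simp add: shifts_def)
  then show ?thesis using ij by (intro exI[of _ m]) (auto simp: m_def)
qed

text \<open>If \<open>g\<close> preserved \<open>H\<close> but moved \<open>e\<close>, then
  \<open>H\<close> would also be a side of \<open>act2 g e\<close>, which does not separate the
  endpoints of \<open>e\<close>.\<close>

lemma halfspace_stabilizer:
  assumes "halfspace H"
  shows "\<exists>e\<in>E. \<forall>g\<in>carrier G. act g ` H = H \<longrightarrow> act2 g e = e"
proof -
  obtain e b where e: "e \<in> E" "H = {p\<in>V. side e p = b}" using assms by (auto simp: halfspace_def)
  obtain c where c: "c \<in> V" "side e c = b" using halfspace_nonempty[OF assms] e by blast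
  have l: "joins e (fst e) (snd e)" using e by (auto simp: joins_def)
  have "act2 g e = e" if g: "g \<in> carrier G" "act g ` H = H" for g
  proof (rule ccontr)
    assume ne: "act2 g e \<noteq> e"
    have "H = {p\<in>V. side (act2 g e) p = side (act2 g e) (act g c)}"
      using act_image_side[OF g(1) e(1) c(1)] g(2) e(2) c(2) by simp
    moreover have "side (act2 g e) (fst e) = side (act2 g e) (snd e)"
      using side_joins[OF l act2_in_E[OF g(1) e(1)]] ne by simp
    ultimately have "fst e \<in> H \<longleftrightarrow> snd e \<in> H" using joins_in_V[OF l] by auto
    then show False using side_joins[OF l e(1)] joins_in_V[OF l] e(2) by auto
  qed
  then show ?thesis using e(1) by blast
qed

text \<open>
  Some powers of \<open>f True\<close> and \<open>f False\<close> move the half-space \<open>H\<close> in the same way as powers of \<open>x\<close>, so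
  their commutators fix it.
\<close>

lemma hyperbolic_centralizer:
  fixes f :: "bool \<Rightarrow> 'a"
  assumes x: "x \<in> carrier G" "fixed x = {}" "V \<noteq> {}"
    and f: "free_family G f" "\<And>b. f b \<otimes> x = x \<otimes> f b"
  shows "\<exists>e\<in>E. \<exists>f' :: bool \<Rightarrow> 'a. free_family G f' \<and> (\<forall>b. act2 (f' b) e = e)"
proof -
  obtain H where H: "halfspace H" "act x ` H \<subset> H" using hyperbolic_halfspace[OF x] .
  note HV = halfspace_nonempty(1)[OF H(1)]
  have fc: "f b \<in> carrier G" for b using f(1) by (auto simp: free_family_def)
  have "\<forall>b. \<exists>m > 0. \<exists>k. shifts x H (f b [^] (m :: nat)) k"
    using ex_power_shifts[OF x(1) H fc f(2)] by blast
  then obtain m :: "bool \<Rightarrow> nat" where m: "\<And>b. m b > 0" "\<And>b. \<exists>k. shifts x H (f b [^] m b) k" by metis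
  \<comment> \<open>A common multiple of both exponents, so that a single power map applies to the
    whole family.\<close>
  define M where "M = m True * m False"
  have "f b [^] M = (f b [^] m b) [^] m (\<not> b)" for b
    using fc[of b] by (cases b) (auto simp: M_def nat_pow_pow mult.commute)
  then have sh: "\<exists>k. shifts x H (f b [^] M) k" for b
    using shifts_nat_pow[OF x(1) HV] m(2)[of b] by metis
  let ?f = "\<lambda>b. f b [^] M"
  let ?f' = "\<lambda>b. if b then ?f True \<otimes> ?f False \<otimes> inv (?f True) \<otimes> inv (?f False)
    else inv (?f True) \<otimes> inv (?f False) \<otimes> ?f True \<otimes> ?f False"
  have "M > 0" using m(1) by (simp add: M_def)
  then have free: "free_family G ?f'"
    using free_family_commutators[OF free_family_power[OF f(1)]] by blast
  obtain k l where kl: "shifts x H (?f True) k" "shifts x H (?f False) l" using sh by blast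
  \<comment> \<open>The second member is the commutator of the inverses, hence the negated
    shifts.\<close>
  have "act (?f' b) ` H = H" for b
    using shifts_commutator[OF x(1) HV kl] shifts_commutator[OF x(1) HV shifts_inv[OF x(1) HV kl(1)] shifts_inv[OF x(1) HV kl(2)]]
      fc by simp
  moreover have "?f' b \<in> carrier G" for b using free by (auto simp: free_family_def)
  moreover obtain e where "e \<in> E" "\<forall>g\<in>carrier G. act g ` H = H \<longrightarrow> act2 g e = e"
    using halfspace_stabilizer[OF H(1)] by blast
  ultimately have "\<forall>b. act2 (?f' b) e = e" "e \<in> E" by blast+
  then show ?thesis using free by blast
qed

end

section \<open>Common fixed points under NF edge stabilizers\<close>

locale NF_tree_action = tree_action +
  assumes V_nonempty: "V \<noteq> {}"
    and edge_stabilizer_NF: "e \<in> E \<Longrightarrow> free_family G (f :: bool \<Rightarrow> 'a) \<Longrightarrow> \<exists>b. act2 (f b) e \<noteq> e"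
begin

lemma free_family_fixed_unique:
  fixes f :: "bool \<Rightarrow> 'a"
  assumes "free_family G f" "\<And>b. p \<in> fixed (f b)" "\<And>b. q \<in> fixed (f b)"
  shows "p = q"
proof (rule ccontr)
  assume "p \<noteq> q"
  moreover have V: "p \<in> V" "q \<in> V" using assms(2,3) by (auto simp: fixed_def)
  ultimately obtain e p' where e: "joins e p p'" "side e p \<noteq> side e q" using ex_first_edge by blast
  have "f b \<in> carrier G" for b using assms(1) by (auto simp: free_family_def)
  then have "act2 (f b) e = e" for b using fixed_first_edge(1)[OF _ assms(2,3) e] by blast
  then show False using edge_stabilizer_NF[OF _ assms(1)] joins_in_V[OF e(1)] by blast
qed

lemma elliptic_if_centralizes_free:
  fixes f :: "bool \<Rightarrow> 'a"
  assumes "x \<in> carrier G" "free_family G f" "\<And>b. f b \<otimes> x = x \<otimes> f b"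
  shows "fixed x \<noteq> {}"
  using hyperbolic_centralizer[OF assms(1) _ V_nonempty assms(2,3)] edge_stabilizer_NF by blast

end

text \<open>Connectedness off a clique is phrased by two-colourings because the sides of an edge
  will supply one. The case of empty \<open>K\<close> makes the graph itself connected.\<close>

locale no_separating_clique =
  fixes X :: "'v set" and adj :: "'v \<Rightarrow> 'v \<Rightarrow> bool"
  assumes finite_X: "finite X"
    and adj_sym: "adj u v \<Longrightarrow> adj v u"
    and not_clique: "\<exists>u\<in>X. \<exists>v\<in>X. u \<noteq> v \<and> \<not> adj u v"
    and connected_off_clique: "\<lbrakk>K \<subseteq> X; \<forall>u\<in>K. \<forall>v\<in>K. u \<noteq> v \<longrightarrow> adj u v;
          \<forall>u\<in>X - K. \<forall>v\<in>X - K. adj u v \<longrightarrow> \<sigma> u = \<sigma> v; u \<in> X - K; v \<in> X - K\<rbrakk>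
        \<Longrightarrow> (\<sigma> u :: bool) = \<sigma> v"
begin

text \<open>If the link were a clique, removing it would isolate \<open>v\<close>. As cliques do not
  separate, nothing but \<open>v\<close> would remain, and \<open>v\<close> together with its link
  would be the whole graph, a clique.\<close>

lemma link_not_clique:
  assumes v: "v \<in> X" "\<not> adj v v"
  shows "\<exists>u\<in>X. \<exists>w\<in>X. adj v u \<and> adj v w \<and> u \<noteq> w \<and> \<not> adj u w"
proof (rule ccontr)
  assume c: "\<not> ?thesis"
  let ?K = "{u\<in>X. adj v u}"
  have K: "\<forall>u\<in>?K. \<forall>w\<in>?K. u \<noteq> w \<longrightarrow> adj u w" using c by blast
  have "\<forall>u\<in>X - ?K. \<forall>w\<in>X - ?K. adj u w \<longrightarrow> (u = v) = (w = v)" using adj_sym by blast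
  then have "u \<in> X - ?K \<Longrightarrow> (u = v) = (v = v)" for u
    using connected_off_clique[of ?K "\<lambda>u. u = v" u v] K v by blast
  then show False using not_clique K adj_sym by blast
qed

end

theorem (in NF_tree_action) common_fixed_point:
  assumes "no_separating_clique X adj" and irrefl: "\<And>v. \<not> adj v v"
    and y: "\<And>v. v \<in> X \<Longrightarrow> y v \<in> carrier G"
    and comm: "\<And>u v. u \<in> X \<Longrightarrow> v \<in> X \<Longrightarrow> adj u v \<Longrightarrow> y u \<otimes> y v = y v \<otimes> y u"
    and free: "\<And>u v. u \<in> X \<Longrightarrow> v \<in> X \<Longrightarrow> u \<noteq> v \<Longrightarrow> \<not> adj u v
      \<Longrightarrow> free_family G (\<lambda>b. if b then y u else y v)"
  shows "\<exists>p. \<forall>v\<in>X. p \<in> fixed (y v)"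
proof -
  interpret no_separating_clique X adj by fact
  have ell: "fixed (y v) \<noteq> {}" if v: "v \<in> X" for v
  proof -
    obtain u w where uw: "u \<in> X" "w \<in> X" "adj v u" "adj v w" "u \<noteq> w" "\<not> adj u w"
      using link_not_clique[OF v irrefl] by blast
    show ?thesis
      by (rule elliptic_if_centralizes_free[OF y[OF v] free[OF uw(1,2,5,6)]])
        (use comm[OF v uw(1,3)] comm[OF v uw(2,4)] in auto)
  qed
  have conv: "tree_convex (fixed (y v))" if "v \<in> X" for v using tree_convex_fixed y that by blast
  have adj_meet: "fixed (y u) \<inter> fixed (y v) \<noteq> {}" if "u \<in> X" "v \<in> X" "adj u v" for u v
    by (rule commuting_fixed_Int[OF y[OF that(1)] y[OF that(2)] comm[OF that] ell[OF that(1)] ell[OF that(2)]])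
  have meet: "fixed (y u) \<inter> fixed (y v) \<noteq> {}" if uv: "u \<in> X" "v \<in> X" for u v
  proof (rule ccontr)
    assume disj: "\<not> ?thesis"
    obtain q where q: "q \<in> fixed (y v)" using ell uv by blast
    obtain p where p: "p \<in> fixed (y u)"
      and min: "\<And>p'. p' \<in> fixed (y u) \<Longrightarrow> card (separators p q) \<le> card (separators p' q)"
      using ex_has_least_nat[of "\<lambda>p. p \<in> fixed (y u)" _ "\<lambda>p. card (separators p q)"] ell[OF uv(1)]
      by blast
    have V: "p \<in> V" "q \<in> V" using p q by (auto simp: fixed_def)
    have "p \<noteq> q" using p q disj by blast
    then obtain e p' where e: "joins e p p'" "side e p \<noteq> side e q" using ex_first_edge V by blast
    have p': "p' \<notin> fixed (y u)" using min[of p'] card_separators_first_edge[OF e V(2)] by auto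
    let ?K = "{w\<in>X. p \<in> fixed (y w) \<and> p' \<in> fixed (y w)}"
    have K: "\<forall>w\<in>?K. \<forall>w'\<in>?K. w \<noteq> w' \<longrightarrow> adj w w'"
    proof (intro ballI impI, rule ccontr)
      fix w w' assume w: "w \<in> ?K" "w' \<in> ?K" "w \<noteq> w'" "\<not> adj w w'"
      have "p = p'"
        by (rule free_family_fixed_unique[OF free[of w w']]) (use w in auto)
      then show False using p p' by simp
    qed
    \<comment> \<open>If the fixed set of \<open>y w\<close> met both sides of \<open>e\<close>,
      convexity would put \<open>e\<close> into it and \<open>w\<close> into \<open>?K\<close>.
      Hence the choice of a fixed point in \<sigma> does not matter.\<close>
    have one_sided: "side e r = side e s"
      if "w \<in> X - ?K" "r \<in> fixed (y w)" "s \<in> fixed (y w)" for w r s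
      using tree_convex_joins[OF conv _ _ e(1), of w r s] that by blast
    define \<sigma> where "\<sigma> w = side e (SOME r. r \<in> fixed (y w))" for w
    have \<sigma>: "\<sigma> w = side e r" if "w \<in> X - ?K" "r \<in> fixed (y w)" for w r
      unfolding \<sigma>_def using one_sided[OF that(1) someI[of "\<lambda>r. r \<in> fixed (y w)"]] that by blast
    have "\<forall>w\<in>X - ?K. \<forall>w'\<in>X - ?K. adj w w' \<longrightarrow> \<sigma> w = \<sigma> w'"
    proof (intro ballI impI)
      fix w w' assume w: "w \<in> X - ?K" "w' \<in> X - ?K" "adj w w'"
      then obtain r where "r \<in> fixed (y w)" "r \<in> fixed (y w')" using adj_meet[of w w'] by blast
      then show "\<sigma> w = \<sigma> w'" using \<sigma> w by blast
    qed
    \<comment> \<open>By the choice of \<open>p\<close>, the edge leaves the fixed set of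
      \<open>y u\<close> at \<open>p\<close>; by disjointness, \<open>y v\<close> does not fix
      \<open>p\<close>.\<close>
    moreover have "u \<in> X - ?K" "v \<in> X - ?K" using uv p p' disj by blast+
    ultimately have "\<sigma> u = \<sigma> v" using connected_off_clique[of ?K \<sigma> u v] K by blast
    moreover have "\<sigma> u = side e p" "\<sigma> v = side e q"
      using \<sigma> p q \<open>u \<in> X - ?K\<close> \<open>v \<in> X - ?K\<close> by blast+
    ultimately show False using e(2) by simp
  qed
  have "X \<noteq> {}" using not_clique by blast
  from helly[OF finite_X this, of "\<lambda>v. fixed (y v)"] conv meet
  show ?thesis by blast
qed

section \<open>Presentations and Bass--Serre trees\<close>

locale presentation = group G for G :: "('a, 'm) monoid_scheme" (structure) +
  fixes X :: "'x set" and R :: "('x word \<times> 'x word) set" and \<iota> :: "'x \<Rightarrow> 'a"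
  assumes gens_closed: "x \<in> X \<Longrightarrow> \<iota> x \<in> carrier G"
    and gens_generate: "g \<in> carrier G \<Longrightarrow> \<exists>w\<in>lists (X \<times> UNIV). g = word_eval G \<iota> w"
    and word_eval_eq_iff: "v \<in> lists (X \<times> UNIV) \<Longrightarrow> w \<in> lists (X \<times> UNIV) \<Longrightarrow>
          word_eval G \<iota> v = word_eval G \<iota> w \<longleftrightarrow> (v, w) \<in> pres_rel X R"

lemma pres_gen_in_carrier: "x \<in> X \<Longrightarrow> pres_gen X R x \<in> carrier (presented_group X R)"
  by (auto simp: pres_gen_def carrier_presented_group)

lemma word_eval_pres_gen:
  assumes "w \<in> lists (X \<times> UNIV)"
  shows "word_eval (presented_group X R) (pres_gen X R) w = pres_rel X R `` {w}"
  using assms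
proof (induction w)
  case Nil
  then show ?case by (simp add: presented_group_def)
next
  case (Cons p w)
  interpret P: group "presented_group X R" by (rule group_presented_group)
  obtain x b where p: "p = (x, b)" by fastforce
  have x: "x \<in> X" and w: "w \<in> lists (X \<times> UNIV)" using Cons p by auto
  let ?c = "\<lambda>w. pres_rel X R `` {w}"
  have "?c [(x, False)] \<otimes>\<^bsub>presented_group X R\<^esub> ?c [(x, True)] = \<one>\<^bsub>presented_group X R\<^esub>"
  proof -
    have "([] @ [(x, False), (x, \<not> False)] @ [], [] @ []) \<in> pres_rel X R"
      using x by (intro pres_rel.cancel) auto
    then show ?thesis using x
      by (subst presented_group_mult) (auto simp: presented_group_def intro!: equiv_class_eq[OF equiv_pres_rel])
  qed
  then have "inv\<^bsub>presented_group X R\<^esub> (?c [(x, True)]) = ?c [(x, False)]"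
    using x by (intro P.inv_equality) (auto simp: carrier_presented_group)
  then have "(if b then pres_gen X R x else inv\<^bsub>presented_group X R\<^esub> (pres_gen X R x)) = ?c [(x, b)]"
    by (simp add: pres_gen_def)
  then show ?case using Cons p x w presented_group_mult[of "[(x, b)]" X w R] by simp
qed

lemma (in group) presentation_iso:
  assumes "\<psi> \<in> iso (presented_group X R) G"
  shows "presentation G X R (\<lambda>x. \<psi> (pres_gen X R x))"
proof
  interpret P: group "presented_group X R" by (rule group_presented_group)
  have hom: "\<psi> \<in> hom (presented_group X R) G" and inj: "inj_on \<psi> (carrier (presented_group X R))"
    and im: "\<psi> ` carrier (presented_group X R) = carrier G"
    using assms by (auto simp: iso_def bij_betw_def)
  have ev: "word_eval G (\<lambda>x. \<psi> (pres_gen X R x)) w = \<psi> (pres_rel X R `` {w})"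
    if w: "w \<in> lists (X \<times> UNIV)" for w
  proof -
    have "pres_gen X R ` fst ` set w \<subseteq> carrier (presented_group X R)"
      using w pres_gen_in_carrier by force
    from P.word_eval_hom[OF is_group hom this] show ?thesis using word_eval_pres_gen[OF w] by metis
  qed
  show "\<psi> (pres_gen X R x) \<in> carrier G" if "x \<in> X" for x
    using im pres_gen_in_carrier[OF that] by blast
  show "\<exists>w\<in>lists (X \<times> UNIV). g = word_eval G (\<lambda>x. \<psi> (pres_gen X R x)) w" if "g \<in> carrier G" for g
    using that ev unfolding im[symmetric] carrier_presented_group image_image by (metis (no_types, lifting) imageE)
  show "word_eval G (\<lambda>x. \<psi> (pres_gen X R x)) v = word_eval G (\<lambda>x. \<psi> (pres_gen X R x)) w \<longleftrightarrow>
      (v, w) \<in> pres_rel X R" if v: "v \<in> lists (X \<times> UNIV)" and w: "w \<in> lists (X \<times> UNIV)" for v w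
  proof -
    have "pres_rel X R `` {v} \<in> carrier (presented_group X R)" "pres_rel X R `` {w} \<in> carrier (presented_group X R)"
      using v w unfolding carrier_presented_group by blast+
    then show ?thesis
      using ev[OF v] ev[OF w] inj pres_rel_class_eq_iff[OF v w] by (metis inj_onD)
  qed
qed

text \<open>The sum mod 2 of the increments \<open>d\<close> along the path in the Cayley graph that
  starts at \<open>g\<close> and reads the word; \<open>\<noteq>\<close> on \<open>bool\<close> is
  addition mod 2. An inverse letter runs along its edge backwards, so it takes the increment at the
  vertex where it arrives.\<close>

fun cocycle :: "('a, 'm) monoid_scheme \<Rightarrow> ('x \<Rightarrow> 'a) \<Rightarrow> ('a \<Rightarrow> 'x \<Rightarrow> bool) \<Rightarrow> 'a \<Rightarrow> 'x word \<Rightarrow> bool" where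
  "cocycle G i d g [] = False"
| "cocycle G i d g ((x, b) # w) =
     (if b then d g x \<noteq> cocycle G i d (g \<otimes>\<^bsub>G\<^esub> i x) w
      else d (g \<otimes>\<^bsub>G\<^esub> inv\<^bsub>G\<^esub> i x) x \<noteq> cocycle G i d (g \<otimes>\<^bsub>G\<^esub> inv\<^bsub>G\<^esub> i x) w)"

context presentation
begin

lemma gens_letters: "w \<in> lists (X \<times> UNIV) \<Longrightarrow> \<iota> ` fst ` set w \<subseteq> carrier G"
  using gens_closed by force

lemma relator_eval:
  assumes "(r, s) \<in> R" "r \<in> lists (X \<times> UNIV)" "s \<in> lists (X \<times> UNIV)"
  shows "word_eval G \<iota> r = word_eval G \<iota> s"
  using pres_rel.relator[of "[]" X "[]" r s R] assms word_eval_eq_iff by auto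

text \<open>Connectedness of the Cayley graph. It yields connectedness of the trees and later
  carries the fixed point property from generators to the Artin group.\<close>

lemma invariant_under_gens:
  assumes step: "\<And>g x. g \<in> carrier G \<Longrightarrow> x \<in> X \<Longrightarrow> P (g \<otimes> \<iota> x) = P g"
    and "g \<in> carrier G" "h \<in> carrier G"
  shows "P g = P h"
proof -
  have word: "P (g \<otimes> word_eval G \<iota> w) = P g" if "w \<in> lists (X \<times> UNIV)" "g \<in> carrier G" for w g
    using that
  proof (induction w arbitrary: g rule: list.induct)
    case Nil
    then show ?case by simp
  next
    case (Cons p w)
    obtain x b where p: "p = (x, b)" by fastforce
    let ?a = "if b then \<iota> x else inv (\<iota> x)"
    have x: "x \<in> X" and w: "w \<in> lists (X \<times> UNIV)" using Cons p by auto
    have a: "?a \<in> carrier G" using gens_closed[OF x] by simp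
    have "P (g \<otimes> word_eval G \<iota> (p # w)) = P (g \<otimes> ?a \<otimes> word_eval G \<iota> w)"
      using Cons.prems a word_eval_closed[OF gens_letters[OF w]] p by (simp add: m_assoc)
    also have "\<dots> = P (g \<otimes> ?a)" using Cons.IH[OF w] a Cons.prems by simp
    also have "\<dots> = P g"
    proof (cases b)
      case False
      then show ?thesis using step[of "g \<otimes> inv (\<iota> x)" x] x gens_closed[OF x] Cons.prems
        by (simp add: m_assoc)
    qed (use step x Cons.prems in simp)
    finally show ?case .
  qed
  obtain w where w: "w \<in> lists (X \<times> UNIV)" "inv g \<otimes> h = word_eval G \<iota> w"
    using gens_generate[of "inv g \<otimes> h"] assms by auto
  have "g \<otimes> (inv g \<otimes> h) = h" using assms by (simp add: m_assoc[symmetric])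
  then show ?thesis using word[OF w(1) assms(2)] w(2) by simp
qed

lemma cocycle_append:
  assumes "u \<in> lists (X \<times> UNIV)" "g \<in> carrier G"
  shows "cocycle G \<iota> d g (u @ v) \<longleftrightarrow> (cocycle G \<iota> d g u \<noteq> cocycle G \<iota> d (g \<otimes> word_eval G \<iota> u) v)"
  using assms
proof (induction u arbitrary: g rule: list.induct)
  case (Cons p u)
  obtain x b where p: "p = (x, b)" by fastforce
  have x: "x \<in> X" and u: "u \<in> lists (X \<times> UNIV)" using Cons p by auto
  have e: "word_eval G \<iota> u \<in> carrier G" using word_eval_closed[OF gens_letters[OF u]] .
  show ?case using Cons.IH[OF u] Cons.prems gens_closed[OF x] e p by (auto simp: m_assoc)
qed simp

text \<open>
  A function on G may be prescribed by its increments along the generators, provided that the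
  increments along both sides of each relator agree: this is the universal property applied to the
  wreath product of \<open>\<int>/2\<close> with G.
\<close>

lemma ex_cocycle:
  assumes rel: "\<And>r s g. (r, s) \<in> R \<Longrightarrow> r \<in> lists (X \<times> UNIV) \<Longrightarrow> s \<in> lists (X \<times> UNIV) \<Longrightarrow> g \<in> carrier G
      \<Longrightarrow> cocycle G \<iota> d g r = cocycle G \<iota> d g s"
  obtains f where "\<And>g x. g \<in> carrier G \<Longrightarrow> x \<in> X \<Longrightarrow> f (g \<otimes> \<iota> x) \<longleftrightarrow> (f g \<noteq> d g x)"
proof -
  have inv: "cocycle G \<iota> d g v = cocycle G \<iota> d g w" if "(v, w) \<in> pres_rel X R" "g \<in> carrier G" for v w g
    using that
  proof (induction arbitrary: g)
    case (cancel u v x b)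
    let ?h = "g \<otimes> word_eval G \<iota> u" and ?m = "[(x, b), (x, \<not> b)]"
    have h: "?h \<in> carrier G" using cancel word_eval_closed[OF gens_letters] by simp
    have x: "\<iota> x \<in> carrier G" using cancel gens_closed by simp
    have m: "?m \<in> lists (X \<times> UNIV)" using cancel by simp
    have "word_eval G \<iota> ?m = \<one>" using x by simp
    \<comment> \<open>A cancelling pair runs along one edge and back, so its increment is counted
      twice.\<close>
    moreover have "cocycle G \<iota> d ?h ?m = False" using x h by (auto simp: m_assoc)
    ultimately have "cocycle G \<iota> d ?h (?m @ v) = cocycle G \<iota> d ?h v"
      using cocycle_append[OF m h, of d v] h by simp
    then show ?case using cocycle_append[OF cancel(1), of g d] cancel.prems by simp
  next
    case (relator u v r s)
    let ?h = "g \<otimes> word_eval G \<iota> u"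
    have h: "?h \<in> carrier G" using relator word_eval_closed[OF gens_letters] by simp
    have "cocycle G \<iota> d ?h (r @ v) = cocycle G \<iota> d ?h (s @ v)"
      using cocycle_append[of _ ?h d v] relator h rel relator_eval by metis
    then show ?case using cocycle_append[OF relator(1), of g d] relator.prems by simp
  qed auto
  define f where "f g = cocycle G \<iota> d \<one> (SOME w. w \<in> lists (X \<times> UNIV) \<and> g = word_eval G \<iota> w)" for g
  have f: "f (word_eval G \<iota> w) = cocycle G \<iota> d \<one> w" if w: "w \<in> lists (X \<times> UNIV)" for w
  proof -
    let ?w = "SOME w'. w' \<in> lists (X \<times> UNIV) \<and> word_eval G \<iota> w = word_eval G \<iota> w'"
    have "?w \<in> lists (X \<times> UNIV) \<and> word_eval G \<iota> w = word_eval G \<iota> ?w"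
      by (rule someI[of _ w]) (use w in simp)
    then have "(w, ?w) \<in> pres_rel X R" using word_eval_eq_iff[OF w] by blast
    then show ?thesis using inv[of w ?w \<one>] by (simp add: f_def)
  qed
  have "f (g \<otimes> \<iota> x) \<longleftrightarrow> (f g \<noteq> d g x)" if g: "g \<in> carrier G" and x: "x \<in> X" for g x
  proof -
    obtain w where w: "w \<in> lists (X \<times> UNIV)" "g = word_eval G \<iota> w" using gens_generate[OF g] by blast
    have l: "w @ [(x, True)] \<in> lists (X \<times> UNIV)" using w x by simp
    have "word_eval G \<iota> (w @ [(x, True)]) = g \<otimes> \<iota> x"
      using word_eval_append[OF gens_letters[OF l]] gens_closed[OF x] w by simp
    then show ?thesis using f[OF l] f[OF w(1)] cocycle_append[OF w(1), of \<one> d "[(x, True)]"] w(2) g by simp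
  qed
  then show thesis using that by blast
qed

end

section \<open>Trees of cosets\<close>

context group
begin

lemma l_coset_eq_iff:
  assumes "subgroup A G" "g \<in> carrier G" "h \<in> carrier G"
  shows "g <# A = h <# A \<longleftrightarrow> inv g \<otimes> h \<in> A"
proof
  assume "g <# A = h <# A"
  moreover have "h \<in> h <# A" using assms subgroup.one_closed[OF assms(1)] by (force simp: l_coset_def)
  ultimately obtain a where "a \<in> A" "h = g \<otimes> a" by (auto simp: l_coset_def)
  then show "inv g \<otimes> h \<in> A" using assms subgroup.mem_carrier[OF assms(1)] by (simp add: m_assoc[symmetric])
next
  assume a: "inv g \<otimes> h \<in> A"
  then have "h = g \<otimes> (inv g \<otimes> h)" using assms by (simp add: m_assoc[symmetric])
  then have "h \<in> g <# A" using a by (auto simp: l_coset_def)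
  then show "g <# A = h <# A" using l_repr_independence[OF _ assms(2,1)] by blast
qed

lemma l_coset_mult_mem:
  assumes "subgroup A G" "g \<in> carrier G" "a \<in> A"
  shows "(g \<otimes> a) <# A = g <# A"
  using assms subgroup.mem_carrier[OF assms(1)]
  by (subst l_coset_eq_iff) (auto simp: inv_mult_group m_assoc subgroup.m_inv_closed)

text \<open>The stabilizer of \<open>h <# A\<close> is the conjugate of \<open>A\<close> by
  \<open>h\<close>, which is proper.\<close>

lemma l_coset_not_fixed:
  assumes "subgroup A G" "A \<noteq> carrier G" "h \<in> carrier G"
  shows "\<exists>g\<in>carrier G. g <# (h <# A) \<noteq> h <# A"
proof -
  obtain b where b: "b \<in> carrier G" "b \<notin> A" using assms subgroup.subset by blast
  let ?g = "h \<otimes> b \<otimes> inv h"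
  have "?g <# (h <# A) = (?g \<otimes> h) <# A"
    using assms b subgroup.subset[OF assms(1)] by (intro lcos_m_assoc) auto
  also have "?g \<otimes> h = h \<otimes> b" using assms b by (simp add: m_assoc)
  also have "(h \<otimes> b) <# A \<noteq> h <# A"
    using l_coset_eq_iff[OF assms(1,3), of "h \<otimes> b"] assms b by (auto simp: m_assoc[symmetric])
  finally show ?thesis using assms b by (intro bexI[of _ ?g]) auto
qed

end

text \<open>Bass--Serre trees have cosets as vertices; the boolean separates the two orbits of an amalgam and is constant for an HNN-extension.\<close>

definition coset_act :: "('a, 'm) monoid_scheme \<Rightarrow> 'a \<Rightarrow> bool \<times> 'a set \<Rightarrow> bool \<times> 'a set" where
  "coset_act G g = map_prod id (l_coset G g)"

text \<open>Amalgams and HNN-extensions share the feature of a single orbit of edges, that of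
  \<open>(p, q)\<close>. One colouring \<open>\<sigma>\<close>, a wall for this base edge, therefore
  gives all walls by translation; it also shows that only elements of \<open>C\<close> fix the base
  edge. \<open>conn\<close> asks that a property constant along edges cannot tell the translates of
  \<open>p\<close> apart.\<close>

lemma (in group) NF_tree_action_cosets:
  fixes p q :: "bool \<times> 'a set"
  defines "V \<equiv> (\<lambda>g. coset_act G g p) ` carrier G \<union> (\<lambda>g. coset_act G g q) ` carrier G"
    and "E \<equiv> (\<lambda>g. (coset_act G g p, coset_act G g q)) ` carrier G"
  assumes pq: "snd p \<subseteq> carrier G" "snd q \<subseteq> carrier G"
    and C: "subgroup C G" "NF_group (G\<lparr>carrier := C\<rparr>)"
    and stab: "\<And>c. c \<in> C \<Longrightarrow> coset_act G c p = p" "\<And>c. c \<in> C \<Longrightarrow> coset_act G c q = q"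
    and wall: "\<And>g. g \<in> carrier G \<Longrightarrow> (\<sigma> (coset_act G g p) :: bool) = \<sigma> (coset_act G g q) \<longleftrightarrow> g \<notin> C"
    and conn: "\<And>Q g h. (\<And>g. g \<in> carrier G \<Longrightarrow> Q (coset_act G g p) = Q (coset_act G g q)) \<Longrightarrow>
      g \<in> carrier G \<Longrightarrow> h \<in> carrier G \<Longrightarrow> (Q (coset_act G g p) :: bool) = Q (coset_act G h p)"
  shows "NF_tree_action G V E (coset_act G)"
proof -
  have pone: "coset_act G \<one> r = r" if "snd r \<subseteq> carrier G" for r
    using that by (cases r) (simp add: coset_act_def lcos_mult_one)
  have pmult: "coset_act G (g \<otimes> h) r = coset_act G g (coset_act G h r)"
    if "snd r \<subseteq> carrier G" "g \<in> carrier G" "h \<in> carrier G" for r g h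
    using that by (cases r) (simp add: coset_act_def lcos_m_assoc)
  have VG: "snd r \<subseteq> carrier G" if "r \<in> V" for r
    using that pq by (auto simp: V_def coset_act_def l_coset_def subset_iff)
  have edge_stab: "g \<in> C" if "g \<in> carrier G" "coset_act G g p = p" "coset_act G g q = q" for g
  proof -
    have "\<sigma> p \<noteq> \<sigma> q" using wall[of \<one>] subgroup.one_closed[OF C(1)] pone pq by simp
    then show ?thesis using wall[OF that(1)] that by simp
  qed
  show ?thesis
  proof
    show "E \<subseteq> V \<times> V" by (auto simp: E_def V_def)
  next
    fix S assume S: "S \<subseteq> V" "S \<noteq> {}" "\<forall>(a, b)\<in>E. a \<in> S \<longleftrightarrow> b \<in> S"
    have e: "coset_act G g p \<in> S \<longleftrightarrow> coset_act G g q \<in> S" if "g \<in> carrier G" for g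
      using S(3) that by (auto simp: E_def)
    obtain g0 where g0: "g0 \<in> carrier G" "coset_act G g0 p \<in> S"
      using S(1,2) e unfolding V_def by blast
    have "coset_act G g p \<in> S" if "g \<in> carrier G" for g
      using conn[of "\<lambda>r. r \<in> S", OF e that g0(1)] g0(2) by blast
    then have "V \<subseteq> S" using e by (auto simp: V_def)
    then show "S = V" using S(1) by blast
  next
    fix e assume "e \<in> E"
    then obtain g where g: "g \<in> carrier G" "e = (coset_act G g p, coset_act G g q)" by (auto simp: E_def)
    let ?\<sigma> = "\<lambda>r. \<sigma> (coset_act G (inv g) r)"
    have tr: "coset_act G (inv g) (coset_act G h r) = coset_act G (inv g \<otimes> h) r"
      if "h \<in> carrier G" "snd r \<subseteq> carrier G" for h r
      using pmult[OF that(2), of "inv g" h] g that by simp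
    have "?\<sigma> (fst e) \<noteq> ?\<sigma> (snd e)"
      using g tr[OF g(1)] pq wall[of \<one>] subgroup.one_closed[OF C(1)] by simp
    moreover have "?\<sigma> (fst f) = ?\<sigma> (snd f)" if f: "f \<in> E - {e}" for f
    proof -
      obtain h where h: "h \<in> carrier G" "f = (coset_act G h p, coset_act G h q)" using f by (auto simp: E_def)
      have "inv g \<otimes> h \<notin> C"
      proof
        assume c: "inv g \<otimes> h \<in> C"
        have "h = g \<otimes> (inv g \<otimes> h)" using g h by (simp add: m_assoc[symmetric])
        then have "coset_act G h r = coset_act G g (coset_act G (inv g \<otimes> h) r)" if "snd r \<subseteq> carrier G" for r
          using pmult[OF that g(1), of "inv g \<otimes> h"] g h by simp
        then have "f = e" using g h pq stab[OF c] by simp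
        then show False using f by simp
      qed
      then show ?thesis using wall[of "inv g \<otimes> h"] g h tr[OF h(1)] pq by simp
    qed
    ultimately have "?\<sigma> (fst e) \<noteq> ?\<sigma> (snd e) \<and> (\<forall>f\<in>E - {e}. ?\<sigma> (fst f) = ?\<sigma> (snd f))" by blast
    then show "\<exists>\<sigma> :: bool \<times> 'a set \<Rightarrow> bool. \<sigma> (fst e) \<noteq> \<sigma> (snd e) \<and> (\<forall>f\<in>E - {e}. \<sigma> (fst f) = \<sigma> (snd f))"
      by (rule exI[of "\<lambda>\<sigma>. \<sigma> (fst e) \<noteq> \<sigma> (snd e) \<and> (\<forall>f\<in>E - {e}. \<sigma> (fst f) = \<sigma> (snd f))"])
  next
    fix g r assume "g \<in> carrier G" "r \<in> V"
    then show "coset_act G g r \<in> V"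
      using pq pmult[of p g] pmult[of q g] by (auto simp: V_def) (metis image_eqI m_closed)+
  next
    fix r assume "r \<in> V" then show "coset_act G \<one> r = r" using pone VG by blast
  next
    fix g h r assume "g \<in> carrier G" "h \<in> carrier G" "r \<in> V"
    then show "coset_act G (g \<otimes> h) r = coset_act G g (coset_act G h r)" using pmult VG by blast
  next
    fix g r s assume g: "g \<in> carrier G" and "(r, s) \<in> E"
    then obtain h where h: "h \<in> carrier G" "r = coset_act G h p" "s = coset_act G h q" by (auto simp: E_def)
    then show "(coset_act G g r, coset_act G g s) \<in> E"
      using pmult[OF pq(1) g h(1)] pmult[OF pq(2) g h(1)] g by (auto simp: E_def intro!: image_eqI[of _ _ "g \<otimes> h"])
  next
    show "V \<noteq> {}" by (auto simp: V_def)
  next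
    fix e and f :: "bool \<Rightarrow> 'a"
    assume e: "e \<in> E" and f: "free_family G f"
    then obtain g where g: "g \<in> carrier G" "e = (coset_act G g p, coset_act G g q)" by (auto simp: E_def)
    have fc: "f b \<in> carrier G" for b using f by (auto simp: free_family_def)
    show "\<exists>b. map_prod (coset_act G (f b)) (coset_act G (f b)) e \<noteq> e"
    proof (rule ccontr)
      assume "\<not> ?thesis"
      then have fx: "coset_act G (f b) (coset_act G g p) = coset_act G g p"
        "coset_act G (f b) (coset_act G g q) = coset_act G g q" for b
        using g by auto
      let ?f = "\<lambda>b. inv g \<otimes> f b \<otimes> inv (inv g)"
      have "coset_act G (?f b) r = r"
        if r: "snd r \<subseteq> carrier G" "coset_act G (f b) (coset_act G g r) = coset_act G g r" for r b
      proof -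
        have "coset_act G (?f b) r = coset_act G (inv g) (coset_act G (f b) (coset_act G g r))"
          using pmult[OF r(1)] g(1) fc by (simp add: m_assoc)
        also have "\<dots> = coset_act G (inv g) (coset_act G g r)" using r(2) by simp
        also have "\<dots> = r" using pmult[OF r(1), of "inv g" g] pone[OF r(1)] g(1) by simp
        finally show ?thesis .
      qed
      then have "?f b \<in> C" for b using edge_stab[of "?f b"] fx pq g(1) fc by simp
      moreover have "free_family G ?f" using free_family_conj[OF f inv_closed[OF g(1)]] .
      ultimately show False using not_NF_group[OF C(1), of ?f] C(2) by blast
    qed
  qed
qed

context group
begin

lemma coset_act_Pair: "coset_act G g (b, M) = (b, g <# M)"
  by (simp add: coset_act_def)

lemma coset_act_mult_mem:
  assumes "subgroup A G" "g \<in> carrier G" "a \<in> A"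
  shows "coset_act G (g \<otimes> a) (b, A) = coset_act G g (b, A)"
  using l_coset_mult_mem[OF assms] by (simp add: coset_act_Pair)

lemma coset_act_subgroup:
  assumes "subgroup A G" "a \<in> A"
  shows "coset_act G a (b, A) = (b, A)"
  using l_coset_mult_mem[OF assms(1) one_closed assms(2)] subgroup.mem_carrier[OF assms]
    lcos_mult_one[OF subgroup.subset[OF assms(1)]] by (simp add: coset_act_Pair)

lemma coset_function:
  assumes A: "subgroup A G" and f: "\<And>g a. g \<in> carrier G \<Longrightarrow> a \<in> A \<Longrightarrow> f (g \<otimes> a) = f g"
  obtains F where "\<And>g. g \<in> carrier G \<Longrightarrow> F (g <# A) = f g"
proof -
  define F where "F M = f (SOME g. g \<in> carrier G \<and> M = g <# A)" for M
  have "F (g <# A) = f g" if g: "g \<in> carrier G" for g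
  proof -
    let ?h = "SOME h. h \<in> carrier G \<and> g <# A = h <# A"
    have h: "?h \<in> carrier G \<and> g <# A = ?h <# A" by (rule someI[of _ g]) (use g in simp)
    then have "inv g \<otimes> ?h \<in> A" using l_coset_eq_iff[OF A g] by blast
    then have "f (g \<otimes> (inv g \<otimes> ?h)) = f g" using f g by blast
    moreover have "g \<otimes> (inv g \<otimes> ?h) = ?h" using g h by (simp add: m_assoc[symmetric])
    ultimately show ?thesis by (simp add: F_def)
  qed
  then show thesis using that by blast
qed

text \<open>The base edge joins the cosets \<open>A\<close> and \<open>B\<close>. If
  \<open>f\<close> colours the cosets of \<open>A\<close>, a wall must give \<open>g <# B\<close>
  the colour \<open>f g\<close> plus the indicator of \<open>C\<close> at \<open>g\<close>, mod 2.
  For both to be well defined on cosets, the increments of \<open>f\<close> have to be zero along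
  \<open>A\<close> and the change of the indicator along \<open>B\<close>.\<close>

lemma amalgam_tree:
  assumes C: "subgroup C G" "NF_group (G\<lparr>carrier := C\<rparr>)" and "splits_as_amalgam_over G C"
  shows "\<exists>V E. NF_tree_action G V E (coset_act G) \<and> (\<forall>p\<in>V. \<exists>g\<in>carrier G. coset_act G g p \<noteq> p)"
proof -
  obtain A B \<psi> where AB: "subgroup A G" "subgroup B G" "C \<subseteq> A" "C \<subseteq> B" "A \<noteq> carrier G" "B \<noteq> carrier G"
    and \<psi>: "\<psi> \<in> iso (presented_group (A <+> B) (amalgam_rels (G\<lparr>carrier := A\<rparr>) (G\<lparr>carrier := B\<rparr>) C)) G"
    and \<psi>A: "\<forall>a\<in>A. \<psi> (pres_gen (A <+> B) (amalgam_rels (G\<lparr>carrier := A\<rparr>) (G\<lparr>carrier := B\<rparr>) C) (Inl a)) = a"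
    and \<psi>B: "\<forall>b\<in>B. \<psi> (pres_gen (A <+> B) (amalgam_rels (G\<lparr>carrier := A\<rparr>) (G\<lparr>carrier := B\<rparr>) C) (Inr b)) = b"
    using assms(3)[unfolded splits_as_amalgam_over_def Let_def, simplified] by blast
  define R where "R = amalgam_rels (G\<lparr>carrier := A\<rparr>) (G\<lparr>carrier := B\<rparr>) C"
  define \<iota> where "\<iota> = (\<lambda>x. \<psi> (pres_gen (A <+> B) R x))"
  have \<iota>: "\<And>a. a \<in> A \<Longrightarrow> \<iota> (Inl a) = a" "\<And>b. b \<in> B \<Longrightarrow> \<iota> (Inr b) = b"
    using \<psi>A \<psi>B by (simp_all add: \<iota>_def R_def)
  interpret presentation G "A <+> B" R \<iota>
    unfolding \<iota>_def R_def by (rule presentation_iso[OF \<psi>])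
  note sub = subgroup.mem_carrier[OF AB(1)] subgroup.mem_carrier[OF AB(2)] subgroup.mem_carrier[OF C(1)]
  have memC: "g \<otimes> c \<in> C \<longleftrightarrow> g \<in> C" if "g \<in> carrier G" "c \<in> C" for g c
    using subgroup.m_closed[OF C(1)] subgroup.m_inv_closed[OF C(1)] that sub
    by (metis inv_closed m_assoc r_inv r_one)
  \<comment> \<open>\<open>f\<close> will be the two-colouring for the edge \<open>C\<close> on the cosets of \<open>A\<close>; on those of \<open>B\<close> it is twisted by \<open>C\<close>.\<close>
  define d where "d g x = (case x of Inl a \<Rightarrow> False | Inr b \<Rightarrow> (g \<in> C) \<noteq> (g \<otimes> b \<in> C))" for g and x :: "'a + 'a"
  obtain f where f: "\<And>g x. g \<in> carrier G \<Longrightarrow> x \<in> A <+> B \<Longrightarrow> f (g \<otimes> \<iota> x) \<longleftrightarrow> (f g \<noteq> d g x)"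
  proof (rule ex_cocycle[of d])
    fix r s g
    assume rs: "(r, s) \<in> R" and g: "g \<in> carrier G"
    from rs consider
        (A) a b where "a \<in> A" "b \<in> A" "r = [(Inl a, True), (Inl b, True)]" "s = [(Inl (a \<otimes> b), True)]"
      | (B) a b where "a \<in> B" "b \<in> B" "r = [(Inr a, True), (Inr b, True)]" "s = [(Inr (a \<otimes> b), True)]"
      | (C) c where "c \<in> C" "r = [(Inl c, True)]" "s = [(Inr c, True)]"
      by (auto simp: R_def amalgam_rels_def mult_table_def)
    then show "cocycle G \<iota> d g r = cocycle G \<iota> d g s"
    proof cases
      case A
      then show ?thesis by (simp add: d_def)
    next
      case B
      \<comment> \<open>The increments along \<open>B\<close> are differences of the indicator of
        \<open>C\<close>, so they telescope.\<close>
      then show ?thesis using g sub by (auto simp: d_def \<iota> m_assoc)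
    next
      case C
      then show ?thesis using memC[OF g] by (simp add: d_def)
    qed
  qed blast
  have fA: "f (g \<otimes> a) = f g" if "g \<in> carrier G" "a \<in> A" for g a
    using f[of g "Inl a"] that \<iota> by (auto simp: d_def)
  have fB: "(f (g \<otimes> b) \<noteq> (g \<otimes> b \<in> C)) = (f g \<noteq> (g \<in> C))" if "g \<in> carrier G" "b \<in> B" for g b
    using f[of g "Inr b"] that \<iota> by (auto simp: d_def)
  obtain FA where FA: "\<And>g. g \<in> carrier G \<Longrightarrow> FA (g <# A) = f g"
    using coset_function[OF AB(1), of f] fA by blast
  obtain FB where FB: "\<And>g. g \<in> carrier G \<Longrightarrow> FB (g <# B) = (f g \<noteq> (g \<in> C))"
    using coset_function[OF AB(2), of "\<lambda>g. f g \<noteq> (g \<in> C)"] fB by blast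
  let ?p = "(False, A)" and ?q = "(True, B)"
  let ?V = "(\<lambda>g. coset_act G g ?p) ` carrier G \<union> (\<lambda>g. coset_act G g ?q) ` carrier G"
  have "NF_tree_action G ?V ((\<lambda>g. (coset_act G g ?p, coset_act G g ?q)) ` carrier G) (coset_act G)"
  proof (rule NF_tree_action_cosets[OF _ _ C, where \<sigma> = "\<lambda>(b, M). if b then FB M else FA M"])
    show "snd ?p \<subseteq> carrier G" "snd ?q \<subseteq> carrier G"
      using subgroup.subset[OF AB(1)] subgroup.subset[OF AB(2)] by simp_all
    show "coset_act G c ?p = ?p" "coset_act G c ?q = ?q" if "c \<in> C" for c
      using coset_act_subgroup AB that by blast+
    show "((case coset_act G g ?p of (b, M) \<Rightarrow> if b then FB M else FA M) =
        (case coset_act G g ?q of (b, M) \<Rightarrow> if b then FB M else FA M)) \<longleftrightarrow> g \<notin> C" if "g \<in> carrier G" for g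
      using FA[OF that] FB[OF that] by (auto simp: coset_act_Pair)
    fix Q :: "bool \<times> 'a set \<Rightarrow> bool" and g h
    assume Q: "\<And>g. g \<in> carrier G \<Longrightarrow> Q (coset_act G g ?p) = Q (coset_act G g ?q)"
      and gh: "g \<in> carrier G" "h \<in> carrier G"
    show "Q (coset_act G g ?p) = Q (coset_act G h ?p)"
    proof (rule invariant_under_gens[OF _ gh])
      fix k x assume k: "k \<in> carrier G" and "x \<in> A <+> B"
      then consider (A) a where "a \<in> A" "x = Inl a" | (B) b where "b \<in> B" "x = Inr b" by blast
      then show "Q (coset_act G (k \<otimes> \<iota> x) ?p) = Q (coset_act G k ?p)"
      proof cases
        case A
        then show ?thesis using coset_act_mult_mem[OF AB(1) k] \<iota> by simp
      next
        case B
        then have "coset_act G (k \<otimes> \<iota> x) ?q = coset_act G k ?q" "k \<otimes> \<iota> x \<in> carrier G"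
          using coset_act_mult_mem[OF AB(2) k] \<iota> sub k by auto
        then show ?thesis using Q k by metis
      qed
    qed
  qed
  moreover have "\<exists>g\<in>carrier G. coset_act G g r \<noteq> r" if "r \<in> ?V" for r
    using that l_coset_not_fixed[OF AB(1,5)] l_coset_not_fixed[OF AB(2,6)] by (auto simp: coset_act_Pair)
  ultimately show ?thesis by blast
qed

text \<open>The base edge joins \<open>A\<close> and \<open>t <# A\<close>, two vertices of one
  orbit; \<open>C\<close> fixes it because \<open>c \<otimes> t = t \<otimes> \<phi> c\<close>. A
  colouring \<open>f\<close> that is constant on cosets of \<open>A\<close> is a wall for it if
  right multiplication by \<open>t\<close> changes \<open>f\<close> exactly on \<open>C\<close>,
  which dictates the increments \<open>d\<close>.\<close>

lemma hnn_tree: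
  assumes C: "subgroup C G" "NF_group (G\<lparr>carrier := C\<rparr>)" and "splits_as_hnn_over G C"
  shows "\<exists>V E. NF_tree_action G V E (coset_act G) \<and> (\<forall>p\<in>V. \<exists>g\<in>carrier G. coset_act G g p \<noteq> p)"
proof -
  obtain A \<phi> \<psi> where A: "subgroup A G" "C \<subseteq> A" "A \<noteq> carrier G"
    and \<phi>: "\<phi> \<in> mon (G\<lparr>carrier := C\<rparr>) (G\<lparr>carrier := A\<rparr>)"
    and \<psi>: "\<psi> \<in> iso (presented_group (insert None (Some ` A)) (hnn_rels (G\<lparr>carrier := A\<rparr>) C \<phi>)) G"
    and \<psi>A: "\<forall>a\<in>A. \<psi> (pres_gen (insert None (Some ` A)) (hnn_rels (G\<lparr>carrier := A\<rparr>) C \<phi>) (Some a)) = a"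
    using assms(3)[unfolded splits_as_hnn_over_def Let_def, simplified] by blast
  define R where "R = hnn_rels (G\<lparr>carrier := A\<rparr>) C \<phi>"
  define \<iota> where "\<iota> = (\<lambda>x. \<psi> (pres_gen (insert None (Some ` A)) R x))"
  define t where "t = \<iota> None"
  have \<iota>: "\<And>a. a \<in> A \<Longrightarrow> \<iota> (Some a) = a" using \<psi>A by (simp add: \<iota>_def R_def)
  interpret presentation G "insert None (Some ` A)" R \<iota>
    unfolding \<iota>_def R_def by (rule presentation_iso[OF \<psi>])
  have t: "t \<in> carrier G" using gens_closed by (simp add: t_def)
  note sub = subgroup.mem_carrier[OF A(1)] subgroup.mem_carrier[OF C(1)]
  have \<phi>A: "\<phi> c \<in> A" if "c \<in> C" for c using \<phi> that by (auto simp: mon_def hom_def)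
  have memC: "g \<otimes> c \<in> C \<longleftrightarrow> g \<in> C" if "g \<in> carrier G" "c \<in> C" for g c
    using subgroup.m_closed[OF C(1)] subgroup.m_inv_closed[OF C(1)] that sub
    by (metis inv_closed m_assoc r_inv r_one)
  have tc: "c \<otimes> t = t \<otimes> \<phi> c" if c: "c \<in> C" for c
  proof -
    have "([(None, False), (Some c, True), (None, True)], [(Some (\<phi> c), True)]) \<in> R"
      using c by (auto simp: R_def hnn_rels_def)
    from relator_eval[OF this] have "inv t \<otimes> (c \<otimes> t) = \<phi> c"
      using c A(2) \<phi>A[OF c] t sub by (auto simp: t_def[symmetric] \<iota> subset_iff)
    moreover have "t \<otimes> (inv t \<otimes> (c \<otimes> t)) = c \<otimes> t" using t sub c by (simp add: m_assoc[symmetric])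
    ultimately show ?thesis by simp
  qed
  define d where "d g x = (case x of Some a \<Rightarrow> False | None \<Rightarrow> g \<in> C)" for g and x :: "'a option"
  obtain f where f: "\<And>g x. g \<in> carrier G \<Longrightarrow> x \<in> insert None (Some ` A) \<Longrightarrow> f (g \<otimes> \<iota> x) \<longleftrightarrow> (f g \<noteq> d g x)"
  proof (rule ex_cocycle[of d])
    fix r s g
    assume rs: "(r, s) \<in> R" and g: "g \<in> carrier G"
    from rs consider
        (A) a b where "r = [(Some a, True), (Some b, True)]" "s = [(Some (a \<otimes> b), True)]"
      | (C) c where "c \<in> C" "r = [(None, False), (Some c, True), (None, True)]" "s = [(Some (\<phi> c), True)]"
      by (auto simp: R_def hnn_rels_def mult_table_def)
    then show "cocycle G \<iota> d g r = cocycle G \<iota> d g s"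
    proof cases
      case A
      then show ?thesis by (simp add: d_def)
    next
      case C
      \<comment> \<open>The path goes back along \<open>t\<close> to
        \<open>g \<otimes> inv t\<close>, then along \<open>c\<close>, then forth along
        \<open>t\<close>. Both crossings contribute the same, since multiplication by
        \<open>c\<close> does not affect membership in \<open>C\<close>.\<close>
      then show ?thesis using memC[of "g \<otimes> inv t" c] g t A(2) \<iota>[of c]
        by (auto simp: d_def t_def[symmetric])
    qed
  qed blast
  have fA: "f (g \<otimes> a) = f g" if "g \<in> carrier G" "a \<in> A" for g a
    using f[of g "Some a"] that \<iota> by (auto simp: d_def)
  have ft: "f (g \<otimes> t) = (f g \<noteq> (g \<in> C))" if "g \<in> carrier G" for g
    using f[of g None] that by (auto simp: d_def t_def)
  obtain F where F: "\<And>g. g \<in> carrier G \<Longrightarrow> F (g <# A) = f g"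
    using coset_function[OF A(1), of f] fA by blast
  have AG: "A \<subseteq> carrier G" using A(1) subgroup.subset by blast
  let ?p = "(False, A)" and ?q = "(False, t <# A)"
  let ?V = "(\<lambda>g. coset_act G g ?p) ` carrier G \<union> (\<lambda>g. coset_act G g ?q) ` carrier G"
  have q: "coset_act G g ?q = coset_act G (g \<otimes> t) ?p" if "g \<in> carrier G" for g
    using lcos_m_assoc[OF AG that t] by (simp add: coset_act_Pair)
  have "NF_tree_action G ?V ((\<lambda>g. (coset_act G g ?p, coset_act G g ?q)) ` carrier G) (coset_act G)"
  proof (rule NF_tree_action_cosets[OF _ _ C, where \<sigma> = "\<lambda>(b, M). F M"])
    show "snd ?p \<subseteq> carrier G" using AG by simp
    show "snd ?q \<subseteq> carrier G" using AG t by (simp add: l_coset_subset_G)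
    show "coset_act G c ?p = ?p" if "c \<in> C" for c using coset_act_subgroup A that by blast
    show "coset_act G c ?q = ?q" if "c \<in> C" for c
      using q[of c] tc[OF that] coset_act_mult_mem[OF A(1) t \<phi>A[OF that]] sub that by (simp add: coset_act_Pair)
    show "((case coset_act G g ?p of (b, M) \<Rightarrow> F M) = (case coset_act G g ?q of (b, M) \<Rightarrow> F M)) \<longleftrightarrow> g \<notin> C"
      if "g \<in> carrier G" for g
      unfolding q[OF that] using F[OF that] F[of "g \<otimes> t"] ft[OF that] that t by (auto simp: coset_act_Pair)
    fix Q :: "bool \<times> 'a set \<Rightarrow> bool" and g h
    assume Q: "\<And>g. g \<in> carrier G \<Longrightarrow> Q (coset_act G g ?p) = Q (coset_act G g ?q)"
      and gh: "g \<in> carrier G" "h \<in> carrier G"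
    show "Q (coset_act G g ?p) = Q (coset_act G h ?p)"
    proof (rule invariant_under_gens[OF _ gh])
      fix k x assume k: "k \<in> carrier G" and "x \<in> insert None (Some ` A)"
      then consider (A) a where "a \<in> A" "x = Some a" | (t) "x = None" by blast
      then show "Q (coset_act G (k \<otimes> \<iota> x) ?p) = Q (coset_act G k ?p)"
      proof cases
        case A
        then show ?thesis using coset_act_mult_mem[OF \<open>subgroup A G\<close> k] \<iota> by simp
      next
        case t
        then show ?thesis using Q[OF k] q[OF k] by (simp add: t_def)
      qed
    qed
  qed
  moreover have "\<exists>g\<in>carrier G. coset_act G g r \<noteq> r" if r: "r \<in> ?V" for r
  proof -
    have "(\<lambda>g. coset_act G g ?q) ` carrier G \<subseteq> (\<lambda>g. coset_act G g ?p) ` carrier G"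
    proof (rule image_subsetI)
      fix g assume g: "g \<in> carrier G"
      then show "coset_act G g ?q \<in> (\<lambda>g. coset_act G g ?p) ` carrier G"
        unfolding q[OF g] using t by (intro imageI) simp
    qed
    then obtain h where "h \<in> carrier G" "r = coset_act G h ?p" using r by blast
    then show ?thesis using l_coset_not_fixed[OF A(1,3)] by (auto simp: coset_act_Pair)
  qed
  ultimately show ?thesis by blast
qed

lemma splitting_tree:
  assumes "splits_nontrivially_over G C" "NF_group (G\<lparr>carrier := C\<rparr>)"
  shows "\<exists>V E. NF_tree_action G V E (coset_act G) \<and> (\<forall>p\<in>V. \<exists>g\<in>carrier G. coset_act G g p \<noteq> p)"
  using assms amalgam_tree hnn_tree unfolding splits_nontrivially_over_def by blast

end

section \<open>Ping-pong on the integer plane\<close>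

fun shear :: "bool \<times> bool \<Rightarrow> int \<times> int \<Rightarrow> int \<times> int" where
  "shear (b, s) (x, y) =
     (let k = (if s then 3 else -3) in if b then (x + k * y, y) else (x, y + k * x))"

text \<open>The ping-pong regions are \<open>x / y > 1\<close>, \<open>x / y < -1\<close>, \<open>0 < x / y < 1\<close> and \<open>-1 < x / y < 0\<close>.\<close>

fun region :: "bool \<times> bool \<Rightarrow> int \<times> int \<Rightarrow> bool" where
  "region (b, s) (x, y) =
     (let u = (if b then x else y); v = (if s then 1 else -1) * (if b then y else x)
      in v > 0 \<and> u > v \<or> v < 0 \<and> u < v)"

text \<open>For \<open>b\<close> true, the shear adds 3 or -3 to x / y. All regions except that of
  the inverse letter have x / y > -1 (respectively x / y < 1), and such ratios are moved beyond 1
  (below -1). For \<open>b\<close> false the same holds of y / x.\<close>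

lemma region_shear: "q \<noteq> (fst p, \<not> snd p) \<Longrightarrow> region q z \<Longrightarrow> region p (shear p z)"
  by (cases p; cases q; cases z) (auto simp: Let_def split: if_splits)

text \<open>The start (1, 1) lies on a boundary between regions, and each letter moves it into its
  own region. This is the reason for the constant 3: with 2, the letter \<open>(True, False)\<close>
  would only reach (-1, 1), again on a boundary.\<close>

lemma region_word: "reduced w \<Longrightarrow> w \<noteq> [] \<Longrightarrow> region (hd w) (foldr shear w (1, 1))"
proof (induction w rule: induct_list012)
  case (2 p)
  then show ?case by (cases p) (auto simp: Let_def)
next
  case (3 p q w)
  then have "q \<noteq> (fst p, \<not> snd p)" "reduced (q # w)" by (auto simp: reduced_def)
  then show ?case using 3 region_shear by (metis foldr.simps(2) list.distinct(1) list.sel(1) o_apply)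
qed simp

lemma shear_word_not_fixed:
  assumes "reduced w" "w \<noteq> []"
  shows "foldr shear w (1, 1) \<noteq> (1, 1)"
proof
  assume "foldr shear w (1, 1) = (1, 1)"
  then have "region (hd w) (1, 1)" using region_word[OF assms] by simp
  then show False by (cases "hd w") (auto simp: Let_def split: if_splits)
qed

section \<open>Right-angled Artin groups\<close>

definition raag_rels :: "('v, 'e) pre_digraph \<Rightarrow> ('v word \<times> 'v word) set" where
  "raag_rels \<Gamma> = {([(u, True), (v, True)], [(v, True), (u, True)]) | u v. (u, v) \<in> arcs_ends \<Gamma>}"

definition raag_gen :: "('v, 'e) pre_digraph \<Rightarrow> 'v \<Rightarrow> 'v word set" where
  "raag_gen \<Gamma> = pres_gen (verts \<Gamma>) (raag_rels \<Gamma>)"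

lemma raag_presentation: "presentation (raag \<Gamma>) (verts \<Gamma>) (raag_rels \<Gamma>) (raag_gen \<Gamma>)"
proof -
  have "id \<in> iso (presented_group (verts \<Gamma>) (raag_rels \<Gamma>)) (raag \<Gamma>)"
    unfolding raag_def raag_rels_def by (rule id_iso)
  moreover have "group (raag \<Gamma>)" unfolding raag_def by (rule group_presented_group)
  ultimately show ?thesis using group.presentation_iso by (fastforce simp: raag_gen_def)
qed

lemma raag_gen_commute:
  assumes "wf_digraph \<Gamma>" "(u, v) \<in> arcs_ends \<Gamma>"
  shows "raag_gen \<Gamma> u \<otimes>\<^bsub>raag \<Gamma>\<^esub> raag_gen \<Gamma> v = raag_gen \<Gamma> v \<otimes>\<^bsub>raag \<Gamma>\<^esub> raag_gen \<Gamma> u"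
proof -
  interpret presentation "raag \<Gamma>" "verts \<Gamma>" "raag_rels \<Gamma>" "raag_gen \<Gamma>" by (rule raag_presentation)
  have uv: "u \<in> verts \<Gamma>" "v \<in> verts \<Gamma>" using wf_digraph.adj_in_verts[OF assms] by auto
  have "([(u, True), (v, True)], [(v, True), (u, True)]) \<in> raag_rels \<Gamma>" using assms(2) by (auto simp: raag_rels_def)
  from relator_eval[OF this] show ?thesis using uv gens_closed by simp
qed

text \<open>The Artin group acts on the integer plane: \<open>u\<close> and \<open>v\<close> by the
  two shears, all other generators trivially. The relators are respected because no edge joins
  \<open>u\<close> and \<open>v\<close>. A nonempty reduced word in \<open>u\<close> and
  \<open>v\<close> moves (1, 1), so it is not trivial.\<close>

lemma free_family_raag:
  assumes uv: "u \<in> verts \<Gamma>" "v \<in> verts \<Gamma>" "u \<noteq> v" "(u, v) \<notin> arcs_ends \<Gamma>" "(v, u) \<notin> arcs_ends \<Gamma>"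
  shows "free_family (raag \<Gamma>) (\<lambda>b. if b then raag_gen \<Gamma> u else raag_gen \<Gamma> v)"
proof -
  interpret presentation "raag \<Gamma>" "verts \<Gamma>" "raag_rels \<Gamma>" "raag_gen \<Gamma>" by (rule raag_presentation)
  define la where "la p = (if fst p = u then shear (True, snd p) else if fst p = v then shear (False, snd p) else id)"
    for p :: "'a \<times> bool"
  have cancel: "shear (b, s) (shear (b, \<not> s) z) = z" for b s z by (cases z) (auto simp: Let_def)
  have inv: "foldr la r z = foldr la s z" if "(r, s) \<in> pres_rel (verts \<Gamma>) (raag_rels \<Gamma>)" for r s z
    using that
  proof (induction arbitrary: z)
    case (cancel r s x b)
    then show ?case using \<open>\<And>z s b. shear (b, s) (shear (b, \<not> s) z) = z\<close> by (auto simp: la_def)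
  next
    case (relator r s c d)
    then obtain a e where "(a, e) \<in> arcs_ends \<Gamma>" "c = [(a, True), (e, True)]" "d = [(e, True), (a, True)]"
      by (auto simp: raag_rels_def)
    moreover from this have "foldr la c y = foldr la d y" for y using uv by (auto simp: la_def)
    ultimately show ?case by simp
  qed auto
  let ?s = "\<lambda>b. if b then u else v"
  let ?f = "\<lambda>b. raag_gen \<Gamma> (?s b)"
  have map: "word_eval (raag \<Gamma>) ?f w = word_eval (raag \<Gamma>) (raag_gen \<Gamma>) (map (map_prod ?s id) w)" for w
    by (induction w) auto
  have lists: "map (map_prod ?s id) w \<in> lists (verts \<Gamma> \<times> UNIV)" for w :: "bool word" using uv by auto
  have fold: "foldr la (map (map_prod ?s id) w) z = foldr shear w z" for w z
    using uv(3) by (induction w) (auto simp: la_def)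
  have "word_eval (raag \<Gamma>) ?f w \<noteq> \<one>\<^bsub>raag \<Gamma>\<^esub>" if "reduced w" "w \<noteq> []" for w
  proof
    assume "word_eval (raag \<Gamma>) ?f w = \<one>\<^bsub>raag \<Gamma>\<^esub>"
    then have "(map (map_prod ?s id) w, []) \<in> pres_rel (verts \<Gamma>) (raag_rels \<Gamma>)"
      using word_eval_eq_iff[OF lists, of "[]" w] by (simp add: map)
    then show False using inv[of _ _ "(1, 1)"] fold shear_word_not_fixed[OF that] by fastforce
  qed
  then have "free_family (raag \<Gamma>) ?f" using uv gens_closed by (auto simp: free_family_def)
  moreover have "?f = (\<lambda>b. if b then raag_gen \<Gamma> u else raag_gen \<Gamma> v)" by (simp add: fun_eq_iff)
  ultimately show ?thesis by simp
qed

section \<open>Components of graphs and separating cliques\<close>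

lemma (in sym_digraph) component_in_connected_components:
  assumes "u \<in> verts G"
  shows "G \<restriction> {v. u \<rightarrow>\<^sup>*\<^bsub>G\<^esub> v} \<in> connected_components G"
proof -
  let ?S = "{v. u \<rightarrow>\<^sup>*\<^bsub>G\<^esub> v}"
  have "strongly_connected (G \<restriction> ?S)" "induced_subgraph (G \<restriction> ?S) G"
    using induce_reachable_is_in_sccs[OF assms] by auto
  then have sub: "subgraph (G \<restriction> ?S) G" and sc: "strongly_connected (G \<restriction> ?S)" by auto
  have "Digraph_Component.connected (G \<restriction> ?S)"
  proof -
    interpret S: wf_digraph "G \<restriction> ?S" using sub by auto
    show ?thesis using sc
      by (auto simp: Digraph_Component.connected_def strongly_connected_def intro: S.reachable_mk_symmetricI)
  qed
  moreover have "H = G \<restriction> ?S"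
    if H: "subgraph (G \<restriction> ?S) H" "subgraph H G" "Digraph_Component.connected H" for H
  proof -
    have S: "?S \<subseteq> verts H" "u \<in> verts H" using subgraph_imp_subverts[OF H(1)] assms by auto
    have "w \<in> ?S" if "w \<in> verts H" for w
    proof -
      have "u \<rightarrow>\<^sup>*\<^bsub>with_proj (mk_symmetric H)\<^esub> w"
        using H(3) that \<open>u \<in> verts H\<close> by (auto simp: Digraph_Component.connected_def strongly_connected_def)
      moreover have "subgraph (mk_symmetric H) (mk_symmetric G)" using subgraph_mk_symmetric[OF H(2)] .
      ultimately have "u \<rightarrow>\<^sup>*\<^bsub>with_proj (mk_symmetric G)\<^esub> w" by (rule pre_digraph.reachable_mono)
      \<comment> \<open>Connectedness refers to the symmetric closure, which adds no reachability in
        a symmetric graph.\<close>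
      then show ?thesis using reachable_mk_symmetric_eq[OF sym_arcs] by simp
    qed
    then have "verts H = ?S" using S(1) by blast
    moreover have "arcs H = arcs (G \<restriction> ?S)"
      using H(1,2) \<open>verts H = ?S\<close> by (auto simp: subgraph_def compatible_def wf_digraph_def)
    ultimately show ?thesis using H(2)
      by (intro pre_digraph.equality) (auto simp: subgraph_def compatible_def)
  qed
  ultimately show ?thesis unfolding connected_components_def max_subgraph_def using sub by blast
qed

lemma no_separating_clique_graph:
  assumes "graph \<Gamma>" "\<not> clique \<Gamma>"
    and sep: "\<not> (\<exists>\<Delta>. induced_subgraph \<Delta> \<Gamma> \<and> clique \<Delta> \<and> separating \<Gamma> \<Delta>)"
  shows "no_separating_clique (verts \<Gamma>) (\<lambda>u v. (u, v) \<in> arcs_ends \<Gamma>)"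
proof -
  interpret graph \<Gamma> by fact
  have ends: "arcs_ends \<Gamma> \<subseteq> {(u, v). (u, v) \<in> verts \<Gamma> \<times> verts \<Gamma> \<and> u \<noteq> v}"
    using adj_in_verts adj_not_same by auto
  show ?thesis
  proof
    show "finite (verts \<Gamma>)" by simp
    show "(v, u) \<in> arcs_ends \<Gamma>" if "(u, v) \<in> arcs_ends \<Gamma>" for u v using that graph_symmetric by blast
    show "\<exists>u\<in>verts \<Gamma>. \<exists>v\<in>verts \<Gamma>. u \<noteq> v \<and> (u, v) \<notin> arcs_ends \<Gamma>"
    proof (rule ccontr)
      assume "\<not> ?thesis"
      then have "arcs_ends \<Gamma> = {(u, v). (u, v) \<in> verts \<Gamma> \<times> verts \<Gamma> \<and> u \<noteq> v}" using ends by auto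
      then show False using assms(1,2) by (auto simp: clique_def complete_digraph_def)
    qed
  next
    fix K \<sigma> u v
    assume K: "K \<subseteq> verts \<Gamma>" "\<forall>u\<in>K. \<forall>v\<in>K. u \<noteq> v \<longrightarrow> (u, v) \<in> arcs_ends \<Gamma>"
      and \<sigma>: "\<forall>u\<in>verts \<Gamma> - K. \<forall>v\<in>verts \<Gamma> - K. (u, v) \<in> arcs_ends \<Gamma> \<longrightarrow> \<sigma> u = (\<sigma> v :: bool)"
      and uv: "u \<in> verts \<Gamma> - K" "v \<in> verts \<Gamma> - K"
    let ?D = "\<Gamma> \<restriction> K" and ?H = "\<Gamma> \<restriction> (verts \<Gamma> - K)"
    have ind: "induced_subgraph ?D \<Gamma>" "induced_subgraph ?H \<Gamma>" using K(1) by auto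
    have "clique ?D"
    proof -
      interpret D: sym_digraph ?D by (rule induced_graph_imp_graph[OF ind(1)])
      interpret D: digraph ?D by (rule digraphI_induced[OF ind(1)])
      have "graph ?D" using D.graphI[OF D.sym_arcs] .
      moreover have "arcs_ends ?D = {(u, v). (u, v) \<in> verts ?D \<times> verts ?D \<and> u \<noteq> v}"
      proof (intro equalityI subrelI)
        fix a b assume "(a, b) \<in> arcs_ends ?D"
        then show "(a, b) \<in> {(u, v). (u, v) \<in> verts ?D \<times> verts ?D \<and> u \<noteq> v}"
          using D.adj_in_verts D.adj_not_same by blast
      next
        fix a b assume "(a, b) \<in> {(u, v). (u, v) \<in> verts ?D \<times> verts ?D \<and> u \<noteq> v}"
        then have "a \<in> K" "b \<in> K" "(a, b) \<in> arcs_ends \<Gamma>" using K(2) by auto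
        then show "(a, b) \<in> arcs_ends ?D" by (auto simp: arcs_ends_conv)
      qed
      ultimately show ?thesis by (auto simp: clique_def complete_digraph_def)
    qed
    then have ns: "\<not> separating \<Gamma> ?D" using sep ind(1) by blast
    interpret H: sym_digraph ?H by (rule induced_graph_imp_graph[OF ind(2)])
    \<comment> \<open>Different components would make the clique \<open>?D\<close>
      separating.\<close>
    have "?H \<restriction> {w. u \<rightarrow>\<^sup>*\<^bsub>?H\<^esub> w} = ?H \<restriction> {w. v \<rightarrow>\<^sup>*\<^bsub>?H\<^esub> w}"
      using ns H.component_in_connected_components[of u] H.component_in_connected_components[of v] uv
      by (auto simp: separating_def)
    then have eq: "{w. u \<rightarrow>\<^sup>*\<^bsub>?H\<^esub> w} = {w. v \<rightarrow>\<^sup>*\<^bsub>?H\<^esub> w}" by (metis induce_subgraph_verts)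
    have "v \<rightarrow>\<^sup>*\<^bsub>?H\<^esub> v" using uv(2) by (intro H.reachable_refl) simp
    then have "v \<in> {w. u \<rightarrow>\<^sup>*\<^bsub>?H\<^esub> w}" unfolding eq by (rule CollectI)
    then have "u \<rightarrow>\<^sup>*\<^bsub>?H\<^esub> v" by (rule CollectD)
    then show "\<sigma> u = \<sigma> v"
    proof (induction rule: H.reachable_induct)
      case (step x y)
      have "x \<in> verts \<Gamma> - K" "y \<in> verts \<Gamma> - K" using H.adj_in_verts[OF step(2)] by auto
      moreover have "(x, y) \<in> arcs_ends \<Gamma>" using dominates_induce_subgraphD[OF step(2)] .
      ultimately show ?case using \<sigma> step(3) by blast
    qed simp
  qed
qed

section \<open>Finite index subgroups and the global fixed point\<close>

context group
begin

text \<open>Let n be the index. Among the cosets of the powers with exponents 0 to n two agree, so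
  some exponent between 1 and n works for \<open>g\<close>. It depends on \<open>g\<close>, as
  \<open>H\<close> may fail to be normal; the factorial of n is a multiple of all such
  exponents.\<close>

lemma finite_index_power:
  assumes "finite_index_subgroup H G"
  shows "\<exists>N > 0. \<forall>g\<in>carrier G. g [^] (N :: nat) \<in> H"
proof -
  have H: "subgroup H G" and fin: "finite (rcosets H)" using assms by (auto simp: finite_index_subgroup_def)
  let ?n = "card (rcosets H)"
  have "g [^] (fact ?n :: nat) \<in> H" if g: "g \<in> carrier G" for g
  proof -
    have "(\<lambda>i :: nat. H #> g [^] i) ` {..?n} \<subseteq> rcosets H"
      using g subgroup.subset[OF H] by (auto intro: rcosetsI)
    then have "\<not> inj_on (\<lambda>i :: nat. H #> g [^] i) {..?n}"
      using card_inj_on_le[OF _ _ fin] by fastforce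
    then obtain k l :: nat where "k \<le> ?n" "l \<le> ?n" "k \<noteq> l" "H #> g [^] k = H #> g [^] l"
      unfolding inj_on_def by blast
    then obtain i j :: nat where ij: "i < j" "j \<le> ?n" "H #> g [^] i = H #> g [^] j"
      by (cases k l rule: linorder_cases) simp_all
    have "g [^] j \<in> H #> g [^] i" using ij(3) rcos_self[OF _ H, of "g [^] j"] g by simp
    then obtain h where h: "h \<in> H" "g [^] j = h \<otimes> g [^] i" by (auto simp: r_coset_def)
    have hG: "h \<in> carrier G" using subgroup.mem_carrier[OF H h(1)] .
    have "g [^] (j - i) \<otimes> g [^] i = g [^] j" using ij(1) g by (simp add: nat_pow_mult)
    then have "g [^] (j - i) = h" using h(2) g hG by simp
    then have mem: "g [^] (j - i) \<in> H" using h(1) by simp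
    have "j - i dvd fact ?n" using ij by (intro dvd_fact) auto
    then obtain k where k: "fact ?n = (j - i) * k" by blast
    have "(g [^] (j - i)) [^] k \<in> H" for k :: nat
      using mem by (induction k) (auto intro: subgroup.m_closed[OF H] subgroup.one_closed[OF H])
    then show ?thesis using g k by (simp add: nat_pow_pow)
  qed
  then show ?thesis by (intro exI[of _ "fact ?n"]) auto
qed

lemma inv_mult_cancel: "g \<in> carrier G \<Longrightarrow> x \<in> carrier G \<Longrightarrow> inv g \<otimes> (g \<otimes> x) = x"
  by (simp add: m_assoc[symmetric])

lemma mult_inv_cancel: "g \<in> carrier G \<Longrightarrow> x \<in> carrier G \<Longrightarrow> g \<otimes> (inv g \<otimes> x) = x"
  by (simp add: m_assoc[symmetric])

lemma conj_mult:
  assumes "g \<in> carrier G" "x \<in> carrier G" "y \<in> carrier G"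
  shows "(g \<otimes> x \<otimes> inv g) \<otimes> (g \<otimes> y \<otimes> inv g) = g \<otimes> (x \<otimes> y) \<otimes> inv g"
  using assms by (simp add: m_assoc inv_mult_cancel)

lemma conj_nat_pow:
  assumes "g \<in> carrier G" "x \<in> carrier G"
  shows "(g \<otimes> x \<otimes> inv g) [^] (n :: nat) = g \<otimes> x [^] n \<otimes> inv g"
  using assms by (induction n) (simp_all add: conj_mult)

end

theorem (in NF_tree_action) global_fixed_point:
  fixes \<Gamma> :: "('v, 'e) pre_digraph"
  assumes "graph \<Gamma>" and ns: "no_separating_clique (verts \<Gamma>) (\<lambda>u v. (u, v) \<in> arcs_ends \<Gamma>)"
    and comm: "commensurable (raag \<Gamma>) G"
  shows "\<exists>p\<in>V. \<forall>g\<in>carrier G. act g p = p"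
proof -
  interpret \<Gamma>: graph \<Gamma> by fact
  interpret ns: no_separating_clique "verts \<Gamma>" "\<lambda>u v. (u, v) \<in> arcs_ends \<Gamma>" by fact
  interpret A: presentation "raag \<Gamma>" "verts \<Gamma>" "raag_rels \<Gamma>" "raag_gen \<Gamma>" by (rule raag_presentation)
  let ?A = "raag \<Gamma>" and ?X = "verts \<Gamma>" and ?gen = "raag_gen \<Gamma>"
  obtain U W \<theta> where UW: "finite_index_subgroup U ?A" "finite_index_subgroup W G"
    and \<theta>: "\<theta> \<in> iso (?A\<lparr>carrier := U\<rparr>) (G\<lparr>carrier := W\<rparr>)"
    using comm by (auto simp: commensurable_def is_iso_def)
  have U: "subgroup U ?A" and W: "subgroup W G" using UW by (auto simp: finite_index_subgroup_def)
  have \<theta>_im: "\<theta> ` U = W" and \<theta>_inj: "inj_on \<theta> U"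
    and \<theta>_mult: "\<And>a b. a \<in> U \<Longrightarrow> b \<in> U \<Longrightarrow> \<theta> (a \<otimes>\<^bsub>?A\<^esub> b) = \<theta> a \<otimes> \<theta> b"
    using \<theta> by (auto simp: iso_def bij_betw_def hom_def)
  have \<theta>_closed: "\<theta> a \<in> carrier G" if "a \<in> U" for a
    using that \<theta>_im subgroup.mem_carrier[OF W] by blast
  have UA: "a \<in> carrier ?A" if "a \<in> U" for a using that subgroup.mem_carrier[OF U] by blast
  obtain N :: nat where N: "N > 0" "\<And>a. a \<in> carrier ?A \<Longrightarrow> a [^]\<^bsub>?A\<^esub> N \<in> U"
    using A.finite_index_power[OF UW(1)] by blast
  obtain M :: nat where M: "M > 0" "\<And>g. g \<in> carrier G \<Longrightarrow> g [^] M \<in> W"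
    using finite_index_power[OF UW(2)] by blast
  \<comment> \<open>A conjugate of an N-th power is an N-th power, hence lies in \<open>U\<close>
    for every \<open>g\<close> of the Artin group and acts on the tree through
    \<open>\<theta>\<close>.\<close>
  define P where "P g v = g \<otimes>\<^bsub>?A\<^esub> ?gen v [^]\<^bsub>?A\<^esub> N \<otimes>\<^bsub>?A\<^esub> inv\<^bsub>?A\<^esub> g" for g v
  have PU: "P g v \<in> U" if "g \<in> carrier ?A" "v \<in> ?X" for g v
    unfolding P_def A.conj_nat_pow[OF that(1) A.gens_closed[OF that(2)], symmetric]
    using that A.gens_closed by (intro N(2)) simp
  have free: "free_family G (\<lambda>b. if b then \<theta> (P g u) else \<theta> (P g v))"
    if g: "g \<in> carrier ?A" and uv: "u \<in> ?X" "v \<in> ?X" "u \<noteq> v" "(u, v) \<notin> arcs_ends \<Gamma>" for g u v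
  proof -
    have vu: "(v, u) \<notin> arcs_ends \<Gamma>" using uv(4) ns.adj_sym by blast
    let ?f = "\<lambda>b. g \<otimes>\<^bsub>?A\<^esub> (if b then ?gen u else ?gen v) [^]\<^bsub>?A\<^esub> N \<otimes>\<^bsub>?A\<^esub> inv\<^bsub>?A\<^esub> g"
    have "free_family ?A ?f"
      using A.free_family_conj[OF A.free_family_power[OF free_family_raag[OF uv vu] N(1)] g] .
    moreover have "range ?f \<subseteq> U" using PU[OF g uv(1)] PU[OF g uv(2)] by (auto simp: P_def)
    ultimately have "free_family (?A\<lparr>carrier := U\<rparr>) ?f" using A.free_family_subgroup[OF U] by blast
    moreover have "\<theta> \<in> hom (?A\<lparr>carrier := U\<rparr>) G" using \<theta>_closed \<theta>_mult by (auto simp: hom_def)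
    ultimately have "free_family G (\<lambda>b. \<theta> (?f b))"
      using group.free_family_hom[OF A.subgroup_imp_group[OF U] _ is_group] \<theta>_inj by simp
    moreover have "(\<lambda>b. \<theta> (?f b)) = (\<lambda>b. if b then \<theta> (P g u) else \<theta> (P g v))"
      by (auto simp: P_def)
    ultimately show ?thesis by simp
  qed
  have commute: "\<theta> (P g u) \<otimes> \<theta> (P g v) = \<theta> (P g v) \<otimes> \<theta> (P g u)"
    if g: "g \<in> carrier ?A" and uv: "u \<in> ?X" "v \<in> ?X" "(u, v) \<in> arcs_ends \<Gamma>" for g u v
  proof -
    let ?x = "?gen u [^]\<^bsub>?A\<^esub> N" and ?y = "?gen v [^]\<^bsub>?A\<^esub> N"
    have xy: "?x \<in> carrier ?A" "?y \<in> carrier ?A" using uv A.gens_closed by auto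
    have "?gen v \<otimes>\<^bsub>?A\<^esub> ?x = ?x \<otimes>\<^bsub>?A\<^esub> ?gen v"
      using A.commute_nat_pow raag_gen_commute[OF \<Gamma>.wf_digraph uv(3)] uv A.gens_closed by metis
    then have "?x \<otimes>\<^bsub>?A\<^esub> ?y = ?y \<otimes>\<^bsub>?A\<^esub> ?x"
      using A.commute_nat_pow[OF A.gens_closed[OF uv(2)] xy(1)] by simp
    moreover have "P g a \<otimes>\<^bsub>?A\<^esub> P g b =
        g \<otimes>\<^bsub>?A\<^esub> (?gen a [^]\<^bsub>?A\<^esub> N \<otimes>\<^bsub>?A\<^esub> ?gen b [^]\<^bsub>?A\<^esub> N) \<otimes>\<^bsub>?A\<^esub> inv\<^bsub>?A\<^esub> g"
      if "a \<in> ?X" "b \<in> ?X" for a b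
      using A.conj_mult[OF g] that A.gens_closed by (simp add: P_def)
    ultimately have "P g u \<otimes>\<^bsub>?A\<^esub> P g v = P g v \<otimes>\<^bsub>?A\<^esub> P g u" using uv by simp
    then show ?thesis using \<theta>_mult PU g uv by metis
  qed
  have ex_fixed: "\<exists>p. \<forall>v\<in>?X. p \<in> fixed (\<theta> (P g v))" if g: "g \<in> carrier ?A" for g
  proof (rule common_fixed_point[OF ns])
    show "\<not> (v, v) \<in> arcs_ends \<Gamma>" for v using \<Gamma>.adj_not_same by blast
    show "\<theta> (P g v) \<in> carrier G" if "v \<in> ?X" for v using \<theta>_closed PU g that by blast
  qed (use commute free g in auto)
  obtain p where p: "\<And>v. v \<in> ?X \<Longrightarrow> p \<in> fixed (\<theta> (P \<one>\<^bsub>?A\<^esub> v))" using ex_fixed by blast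
  \<comment> \<open>A substitute for "\<open>g\<close> fixes \<open>p\<close>", as \<open>g\<close>
    may not act on the tree: \<open>p\<close> is also a common fixed point of the family conjugated
    by \<open>g\<close>.\<close>
  define T where "T g \<longleftrightarrow> (\<forall>v\<in>?X. p \<in> fixed (\<theta> (P g v)))" for g
  \<comment> \<open>The powers of the generators in the link of \<open>x\<close> commute with \<open>x\<close> and already determine the fixed point.\<close>
  have T_step: "T (g \<otimes>\<^bsub>?A\<^esub> ?gen x) = T g" if g: "g \<in> carrier ?A" and x: "x \<in> ?X" for g x
  proof -
    let ?g = "g \<otimes>\<^bsub>?A\<^esub> ?gen x"
    have gx: "?g \<in> carrier ?A" using g x A.gens_closed by simp
    have "(x, x) \<notin> arcs_ends \<Gamma>" using \<Gamma>.adj_not_same by blast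
    then obtain u w where uw: "u \<in> ?X" "w \<in> ?X" "(x, u) \<in> arcs_ends \<Gamma>" "(x, w) \<in> arcs_ends \<Gamma>"
      "u \<noteq> w" "(u, w) \<notin> arcs_ends \<Gamma>" using ns.link_not_clique[OF x] by blast
    have P_eq: "P ?g v = P g v" if v: "v \<in> ?X" "(x, v) \<in> arcs_ends \<Gamma>" for v
    proof -
      let ?y = "?gen v [^]\<^bsub>?A\<^esub> N"
      have y: "?y \<in> carrier ?A" "?gen x \<in> carrier ?A" using v x A.gens_closed by auto
      have "?gen x \<otimes>\<^bsub>?A\<^esub> ?y = ?y \<otimes>\<^bsub>?A\<^esub> ?gen x"
        using A.commute_nat_pow raag_gen_commute[OF \<Gamma>.wf_digraph v(2)] v x A.gens_closed by metis
      then have "?gen x \<otimes>\<^bsub>?A\<^esub> ?y \<otimes>\<^bsub>?A\<^esub> inv\<^bsub>?A\<^esub> ?gen x = ?y"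
        using y by (simp add: A.m_assoc)
      moreover have "P ?g v = g \<otimes>\<^bsub>?A\<^esub> (?gen x \<otimes>\<^bsub>?A\<^esub> ?y \<otimes>\<^bsub>?A\<^esub> inv\<^bsub>?A\<^esub> ?gen x) \<otimes>\<^bsub>?A\<^esub> inv\<^bsub>?A\<^esub> g"
        using y g by (simp add: P_def A.m_assoc A.inv_mult_group)
      ultimately show ?thesis by (simp add: P_def)
    qed
    have same: "q = r" if q: "\<forall>v\<in>?X. q \<in> fixed (\<theta> (P g v))" and r: "\<forall>v\<in>?X. r \<in> fixed (\<theta> (P ?g v))" for q r
      by (rule free_family_fixed_unique[OF free[OF g uw(1,2,5,6)]])
        (use q r uw P_eq[OF uw(1,3)] P_eq[OF uw(2,4)] in auto)
    show ?thesis unfolding T_def using same ex_fixed[OF g] ex_fixed[OF gx] by metis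
  qed
  have T: "T g" if "g \<in> carrier ?A" for g
    using A.invariant_under_gens[of T, OF T_step that A.one_closed] p by (simp add: T_def)
  obtain u w where uw: "u \<in> ?X" "w \<in> ?X" "u \<noteq> w" "(u, w) \<notin> arcs_ends \<Gamma>" using ns.not_clique by blast
  have pV: "p \<in> V" using p[OF uw(1)] by (simp add: fixed_def)
  let ?f = "\<lambda>b. if b then \<theta> (P \<one>\<^bsub>?A\<^esub> u) else \<theta> (P \<one>\<^bsub>?A\<^esub> w)"
  have f: "free_family G ?f" using free[OF A.one_closed uw] .
  have fW: "?f b \<in> W" "?f b \<in> carrier G" for b
    using \<theta>_im PU[OF A.one_closed] uw \<theta>_closed by auto
  \<comment> \<open>Elements of \<open>W\<close> do act: \<open>k\<close> maps common fixed points
    of the family conjugated by the inverse of \<open>h\<close> to those of the original family, and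
    \<open>p\<close> is the only one of the latter.\<close>
  have W_fixes: "act k p = p" if k: "k \<in> W" for k
  proof -
    obtain h where h: "h \<in> U" "k = \<theta> h" using k \<theta>_im by blast
    have hA: "h \<in> carrier ?A" using UA h by blast
    have kG: "k \<in> carrier G" using \<theta>_closed h by blast
    have "act k p \<in> fixed (\<theta> (P \<one>\<^bsub>?A\<^esub> v))" if v: "v \<in> ?X" for v
    proof -
      let ?i = "inv\<^bsub>?A\<^esub> h"
      have PP: "P \<one>\<^bsub>?A\<^esub> v \<in> U" "P ?i v \<in> U" using PU v hA by auto
      have "P \<one>\<^bsub>?A\<^esub> v \<otimes>\<^bsub>?A\<^esub> h = h \<otimes>\<^bsub>?A\<^esub> P ?i v"
        using hA v A.gens_closed by (simp add: P_def A.m_assoc A.mult_inv_cancel)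
      then have eq: "\<theta> (P \<one>\<^bsub>?A\<^esub> v) \<otimes> k = k \<otimes> \<theta> (P ?i v)"
        using \<theta>_mult PP h by metis
      have "act (\<theta> (P ?i v)) p = p" using T[of ?i] hA v by (auto simp: T_def fixed_def)
      then have "act (\<theta> (P \<one>\<^bsub>?A\<^esub> v)) (act k p) = act k p"
        using act_mult[OF \<theta>_closed[OF PP(1)] kG pV] act_mult[OF kG \<theta>_closed[OF PP(2)] pV] eq by simp
      then show ?thesis using pV kG by (simp add: fixed_def act_closed)
    qed
    then show ?thesis using free_family_fixed_unique[OF f, of "act k p" p] p uw by simp
  qed
  have "act g p = p" if g: "g \<in> carrier G" for g
  proof -
    \<comment> \<open>The M-th powers lie in \<open>W\<close>, so they fix \<open>p\<close>; being
      closed under conjugation, they fix \<open>act g p\<close> as well. Those of a free family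
      force the two points to agree.\<close>
    have "act g p \<in> fixed (x [^] M)" if x: "x \<in> carrier G" for x
    proof -
      let ?y = "inv g \<otimes> x \<otimes> inv (inv g)"
      have "x [^] M \<otimes> g = g \<otimes> ?y [^] M"
        using conj_nat_pow[OF inv_closed[OF g] x, of M] g x by (simp add: m_assoc mult_inv_cancel)
      moreover have "act (?y [^] M) p = p" using W_fixes M(2) g x by simp
      ultimately have "act (x [^] M) (act g p) = act g p"
        using act_mult[of "x [^] M" g p] act_mult[of g "?y [^] M" p] g x pV by simp
      then show ?thesis using g pV by (simp add: fixed_def act_closed)
    qed
    moreover have "p \<in> fixed (x [^] M)" if "x \<in> carrier G" for x
      using W_fixes M(2) that pV by (simp add: fixed_def)
    ultimately show ?thesis using free_family_fixed_unique[OF free_family_power[OF f M(1)]] fW(2) by blast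
  qed
  then show ?thesis using pV by blast
qed

theorem corollary3p7:
  fixes \<Gamma> :: "('v, 'e) pre_digraph" and G :: "('g, 'm) monoid_scheme" and C :: "'g set"
  assumes "graph \<Gamma>"
    and "\<not> clique \<Gamma>"
    and "\<not> (\<exists>\<Delta>. induced_subgraph \<Delta> \<Gamma> \<and> clique \<Delta> \<and> separating \<Gamma> \<Delta>)"
    and "group G"
    and "splits_nontrivially_over G C"
    and "NF_group (G\<lparr>carrier := C\<rparr>)"
  shows "\<not> commensurable (raag \<Gamma>) G"
proof
  assume comm: "commensurable (raag \<Gamma>) G"
  obtain V E where tree: "NF_tree_action G V E (coset_act G)"
    and no_fixed: "\<forall>p\<in>V. \<exists>g\<in>carrier G. coset_act G g p \<noteq> p"
    using group.splitting_tree[OF assms(4-6)] by blast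
  show False
    using NF_tree_action.global_fixed_point[OF tree assms(1) no_separating_clique_graph[OF assms(1-3)] comm]
      no_fixed by blast
qed

end
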